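(* Let $\mathcal{L}$ be a Lévy operator that is $p$-hypercontractive for some $p\ge 2$, i.e. $\|u(t)\|_{q(t)}\le A_p(t)\|u_0\|_p$ for $0\le t<t_\infty$ and every $u_0\in L^p(\mathbb{R}^N)$, where $t_\infty\in(0,\infty]$, $q$ is an increasing $C^1$ function on $[0,t_\infty)$ with $q(0)=p$, $\lim_{t\to t_\infty}q(t)=\infty$ and $q'(0)>0$, and where $$A_p(0)=\lim_{h\to0^+}A_p(h)=1,\qquad A_p'(0)=\lim_{h\to0^+}\frac{A_p(h)-1}{h}<\infty .$$ Then for every $f\in L^1(\mathbb{R}^N)\cap L^p(\mathbb{R}^N)\cap H_{\mathcal{L}}(\mathbb{R}^N)$ the $p$-logarithmic Sobolev inequality $$\mathrm{Ent}(|f|^p)\le C(p)\|f\|_p^p+D(p)\,\mathcal{E}(|f|^{p-2}f,f)$$ holds with $$C(p)=\frac{p^2A_p'(0)}{q'(0)},\qquad D(p)=\frac{p^2}{q'(0)}.$$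
   Context: $L^p=L^p(\mathbb{R}^N)$ with Lebesgue measure and norm $\|\cdot\|_p$. A Lévy operator is $\mathcal{L}f(x)=\mathrm{P.V.}\int_{\mathbb{R}^N}(f(x)-f(y))J(x,y)\,dy$ with $J\ge0$ measurable, $J(x,y)=J(y,x)$ and $\sup_x\int J(x,y)\min\{1,|x-y|^2\}\,dy<\infty$. Set $\mathcal{E}(f,g)=\frac12\iint (f(x)-f(y))(g(x)-g(y))J(x,y)\,dx\,dy$, $\overline{\mathcal{E}}(f)=\mathcal{E}(f,f)$, and $H_{\mathcal{L}}(\mathbb{R}^N)=\{f\in L^2:\overline{\mathcal{E}}(f)<\infty\}$ with norm $\|f\|_2+\overline{\mathcal{E}}(f)^{1/2}$; $\mathcal{L}$ is understood as the self-adjoint operator on $L^2$ given by $\langle\mathcal{L}f,g\rangle=\mathcal{E}(f,g)$. For $u_0\in L^2$, the solution of $\partial_tu+\mathcal{L}u=0$, $u(0)=u_0$, is the unique $u\in C([0,\infty);L^2)\cap C^1((0,\infty);L^2)\cap C((0,\infty);H_{\mathcal{L}})$ satisfying $\frac{du}{dt}+\mathcal{L}u=0$ in $(0,\infty)$ and $u(0)=u_0$; write $e^{-t\mathcal{L}}u_0=u(t)$. This semigroup is self-adjoint, positivity preserving and contractive in every $L^p$-norm; for $u_0\in L^p$ the solution is defined by extending $e^{-t\mathcal{L}}$ continuously from $L^2\cap L^p$ to $L^p$. Entropy: $\mathrm{Ent}(f)=\int_{\mathbb{R}^N}\Phi(|f|)-\Phi\left(\int_{\mathbb{R}^N}|f|\right)$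 with $\Phi(s)=s\log s$ ($\Phi(0)=0$). *)

theory Defs
  imports "HOL-Analysis.Analysis"
begin

text \<open>
  The space \<open>R^N\<close> is a type \<^typ>\<open>'a::euclidean_space\<close>; elements of \<open>L^p\<close> are represented by
  Lebesgue measurable functions \<open>'a \<Rightarrow> real\<close>, with no quotient by equality almost everywhere.
\<close>

definition Lp :: "real \<Rightarrow> ('a::euclidean_space \<Rightarrow> real) set" where
  "Lp p = {f \<in> borel_measurable lebesgue. integrable lebesgue (\<lambda>x. \<bar>f x\<bar> powr p)}"

definition lpnorm :: "real \<Rightarrow> ('a::euclidean_space \<Rightarrow> real) \<Rightarrow> real" where
  "lpnorm p f = (integral\<^sup>L lebesgue (\<lambda>x. \<bar>f x\<bar> powr p)) powr (1 / p)"

text \<open>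
  Extended-valued Lebesgue integral: positive part minus negative part.  It agrees with the Bochner
  integral on integrable functions, but keeps the values \<open>\<infinity>\<close> and \<open>-\<infinity>\<close>, which the Bochner
  integral would turn into \<open>0\<close>.  It is meaningful only if one of the two parts is finite
  (in \<^typ>\<open>ereal\<close>, \<open>\<infinity> - \<infinity> = \<infinity>\<close>).
\<close>

definition ext_lint :: "'b measure \<Rightarrow> ('b \<Rightarrow> real) \<Rightarrow> ereal" where
  "ext_lint M f = enn2ereal (\<integral>\<^sup>+ x. ennreal (f x) \<partial>M) - enn2ereal (\<integral>\<^sup>+ x. ennreal (- f x) \<partial>M)"

text \<open>In the entropy, \<open>s log s\<close> is \<open>0\<close> at \<open>s = 0\<close> since \<open>0 * _ = 0\<close>.  The number \<open>Ent f\<close> is meant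
  for integrable \<open>f\<close>.\<close>

definition Ent :: "('a::euclidean_space \<Rightarrow> real) \<Rightarrow> ereal" where
  "Ent f = ext_lint lebesgue (\<lambda>x. \<bar>f x\<bar> * ln \<bar>f x\<bar>)
     - ereal ((\<integral>x. \<bar>f x\<bar> \<partial>lebesgue) * ln (\<integral>x. \<bar>f x\<bar> \<partial>lebesgue))"

definition levy_kernel :: "('a::euclidean_space \<Rightarrow> 'a \<Rightarrow> real) \<Rightarrow> bool" where
  "levy_kernel J \<longleftrightarrow>
     (\<lambda>(x, y). J x y) \<in> borel_measurable (lebesgue :: ('a \<times> 'a) measure) \<and>
     (\<forall>x y. 0 \<le> J x y) \<and> (\<forall>x y. J x y = J y x) \<and>
     (SUP x. \<integral>\<^sup>+ y. ennreal (J x y * min 1 ((norm (x - y))\<^sup>2)) \<partial>lebesgue) < \<infinity>"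

definition form :: "('a::euclidean_space \<Rightarrow> 'a \<Rightarrow> real) \<Rightarrow> ('a \<Rightarrow> real) \<Rightarrow> ('a \<Rightarrow> real) \<Rightarrow> ereal" where
  "form J f g =
     ereal (1/2) * ext_lint (lebesgue :: ('a \<times> 'a) measure) (\<lambda>(x, y). (f x - f y) * (g x - g y) * J x y)"

definition HL :: "('a::euclidean_space \<Rightarrow> 'a \<Rightarrow> real) \<Rightarrow> ('a \<Rightarrow> real) set" where
  "HL J = {f \<in> Lp 2. form J f f < \<infinity>}"

definition HLnorm :: "('a::euclidean_space \<Rightarrow> 'a \<Rightarrow> real) \<Rightarrow> ('a \<Rightarrow> real) \<Rightarrow> real" where
  "HLnorm J f = lpnorm 2 f + sqrt (real_of_ereal (form J f f))"

text \<open>The self-adjoint operator of the form, as a relation: \<open>levy_op J f h\<close> means that \<open>f\<close> lies in its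
  domain and is mapped to (the class of) \<open>h\<close>.\<close>

definition levy_op :: "('a::euclidean_space \<Rightarrow> 'a \<Rightarrow> real) \<Rightarrow> ('a \<Rightarrow> real) \<Rightarrow> ('a \<Rightarrow> real) \<Rightarrow> bool" where
  "levy_op J f h \<longleftrightarrow> f \<in> HL J \<and> h \<in> Lp 2 \<and>
     (\<forall>g \<in> HL J. form J f g = ereal (\<integral>x. h x * g x \<partial>lebesgue))"

text \<open>The \<open>L^2\<close> solution \<open>u\<close> of \<open>du/dt + L u = 0\<close>, \<open>u(0) = u0\<close>; the function \<open>v\<close> is \<open>du/dt\<close>.\<close>

definition levy_solution ::
  "('a::euclidean_space \<Rightarrow> 'a \<Rightarrow> real) \<Rightarrow> ('a \<Rightarrow> real) \<Rightarrow> (real \<Rightarrow> 'a \<Rightarrow> real) \<Rightarrow> bool" where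
  "levy_solution J u0 u \<longleftrightarrow>
     (AE x in lebesgue. u 0 x = u0 x) \<and>
     (\<forall>t\<ge>0. u t \<in> Lp 2 \<and>
        ((\<lambda>s. lpnorm 2 (\<lambda>x. u s x - u t x)) \<longlongrightarrow> 0) (at t within {0..})) \<and>
     (\<forall>t>0. u t \<in> HL J \<and> ((\<lambda>s. HLnorm J (\<lambda>x. u s x - u t x)) \<longlongrightarrow> 0) (at t)) \<and>
     (\<exists>v. \<forall>t>0. v t \<in> Lp 2 \<and>
        ((\<lambda>s. lpnorm 2 (\<lambda>x. v s x - v t x)) \<longlongrightarrow> 0) (at t) \<and>
        ((\<lambda>s. lpnorm 2 (\<lambda>x. (u s x - u t x) / (s - t) - v t x)) \<longlongrightarrow> 0) (at t) \<and>
        levy_op J (u t) (\<lambda>x. - v t x))"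

text \<open>\<open>S t\<close> is \<open>exp (-t L)\<close> on \<open>L^2\<close>, together with its continuous extension from
  \<open>L^2 \<inter> L^p\<close> to \<open>L^p\<close>.  These conditions determine \<open>S t f\<close> almost everywhere for every
  \<open>f\<close> in \<open>L^2 \<union> L^p\<close> and \<open>t \<ge> 0\<close>.\<close>

definition levy_semigroup ::
  "('a::euclidean_space \<Rightarrow> 'a \<Rightarrow> real) \<Rightarrow> real \<Rightarrow> (real \<Rightarrow> ('a \<Rightarrow> real) \<Rightarrow> 'a \<Rightarrow> real) \<Rightarrow> bool" where
  "levy_semigroup J p S \<longleftrightarrow>
     (\<forall>u0 \<in> Lp 2. levy_solution J u0 (\<lambda>t. S t u0)) \<and>
     (\<forall>t\<ge>0. \<forall>f \<in> Lp p. S t f \<in> Lp p \<and>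
        (\<forall>fn. (\<forall>n::nat. fn n \<in> Lp 2 \<inter> Lp p) \<and> (\<lambda>n. lpnorm p (\<lambda>x. fn n x - f x)) \<longlonglongrightarrow> 0
           \<longrightarrow> (\<lambda>n. lpnorm p (\<lambda>x. S t (fn n) x - S t f x)) \<longlonglongrightarrow> 0))"

text \<open>
  The solution from \<open>u0\<close> is \<open>S t u0\<close>, \<open>q'\<close> is the derivative of \<open>q\<close>, and \<open>A'\<close> is the right derivative
  \<open>A'(0)\<close>, a limit in the extended reals that is required to be \<open>< \<infinity>\<close>.  The filter
  \<open>filtercomap ereal (at_left tinf)\<close> is that of real \<open>t\<close> tending to \<open>tinf\<close> from below; it is
  \<^const>\<open>at_top\<close> for \<open>tinf = \<infinity>\<close>.  ``Increasing'' is nondecreasing.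
\<close>

definition hypercontractive ::
  "(real \<Rightarrow> ('a::euclidean_space \<Rightarrow> real) \<Rightarrow> 'a \<Rightarrow> real) \<Rightarrow> real \<Rightarrow> ereal \<Rightarrow>
   (real \<Rightarrow> real) \<Rightarrow> (real \<Rightarrow> real) \<Rightarrow> (real \<Rightarrow> real) \<Rightarrow> ereal \<Rightarrow> bool" where
  "hypercontractive S p tinf q q' A A' \<longleftrightarrow>
     (let I = {t::real. 0 \<le> t \<and> ereal t < tinf} in
       0 < tinf \<and>
       mono_on I q \<and>
       (\<forall>t\<in>I. (q has_real_derivative q' t) (at t within I)) \<and> continuous_on I q' \<and>
       q 0 = p \<and> filterlim q at_top (filtercomap ereal (at_left tinf)) \<and> 0 < q' 0 \<and>
       A 0 = 1 \<and> (A \<longlongrightarrow> 1) (at_right 0) \<and>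
       ((\<lambda>h. ereal ((A h - 1) / h)) \<longlongrightarrow> A') (at_right 0) \<and> A' < \<infinity> \<and>
       (\<forall>t\<in>I. \<forall>u0 \<in> Lp p. S t u0 \<in> Lp (q t) \<and> lpnorm (q t) (S t u0) \<le> A t * lpnorm p u0))"

end

theory Submission
  imports Defs
begin

text \<open>
  Let \<open>g = \<bar>f\<bar>\<^sup>p\<^sup>-\<^sup>2 f\<close>.  By Hoelder and hypercontractivity
  \<open>\<integral> u(t) g \<le> A(t) \<parallel>f\<parallel>\<^sub>p \<parallel>g\<parallel>\<^sub>r\<close> with \<open>r = q(t) / (q(t) - 1)\<close>, and at \<open>t = 0\<close> this is an equality.
  Comparing right derivatives at \<open>0\<close> gives the claim: the left side contributes \<open>- \<E>(f, g)\<close>, and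
  since \<open>g\<close> is fixed, the only norm to differentiate is \<open>\<parallel>g\<parallel>\<^sub>r\<close> in its exponent, which produces the entropy.

  For \<open>f\<close> in the form domain only the bound
  \<open>\<integral> (f - u(t)) g \<le> t (\<E>(f, g) + o(1))\<close> is needed.  It follows from the inequality
  \<open>\<parallel>u(t) - w\<parallel>\<^sup>2 - \<parallel>f - w\<parallel>\<^sup>2 \<le> t (\<E>(w, w) - \<E>(u(s), u(s)))\<close>, valid for some \<open>s\<close> in \<open>(0, t)\<close>, with \<open>w = f + \<epsilon> g\<close>,
  and from lower semicontinuity of the energy (Fatou).

  The function \<open>g\<close> lies in the form domain when \<open>f\<close> is bounded.  The general case follows by truncating
  \<open>f\<close>: this decreases \<open>\<E>(g, f)\<close>, and the entropies converge monotonically once the truncation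
  level is at least \<open>1\<close>.
\<close>

section \<open>Lebesgue measurability on the product\<close>

text \<open>\<open>lebesgue\<close> on the product type is the completion of the product of Borel
  measures, so functions of one variable can be lifted to it only after null sets are known to pull
  back to null sets. The cylinders have measure \<open>0\<close> times infinity, which is
  \<open>0\<close>.\<close>

lemma vimage_null_sets_lborel_prod:
  assumes "N \<in> null_sets (lborel :: 'a::euclidean_space measure)"
  shows "fst -` N \<in> null_sets (lborel :: ('a \<times> 'a) measure)"
    and "snd -` N \<in> null_sets (lborel :: ('a \<times> 'a) measure)"
proof -
  have [simp]: "fst -` N = N \<times> (UNIV :: 'a set)" "snd -` N = (UNIV :: 'a set) \<times> N" by auto
  have "emeasure (lborel \<Otimes>\<^sub>M lborel) (N \<times> (UNIV :: 'a set)) = 0"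
    "emeasure (lborel \<Otimes>\<^sub>M lborel) ((UNIV :: 'a set) \<times> N) = 0"
    using assms by (simp_all add: lborel.emeasure_pair_measure_Times null_sets_def)
  moreover have "N \<in> sets borel" using assms by auto
  ultimately show "fst -` N \<in> null_sets (lborel :: ('a \<times> 'a) measure)"
    "snd -` N \<in> null_sets (lborel :: ('a \<times> 'a) measure)"
    by (auto simp: lborel_prod null_sets_def borel_Times)
qed

text \<open>Continuity makes the projections Borel measurable; between completions one also needs
  that preimages of null sets are null.\<close>

lemma measurable_lebesgue_fst_snd:
  shows "fst \<in> (lebesgue :: ('a::euclidean_space \<times> 'a) measure) \<rightarrow>\<^sub>M lebesgue"
    and "snd \<in> (lebesgue :: ('a \<times> 'a) measure) \<rightarrow>\<^sub>M lebesgue"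
proof -
  have m: "fst \<in> (lebesgue :: ('a \<times> 'a) measure) \<rightarrow>\<^sub>M lborel"
    "snd \<in> (lebesgue :: ('a \<times> 'a) measure) \<rightarrow>\<^sub>M lborel"
    by (auto intro!: measurable_completion borel_measurable_continuous_onI continuous_intros)
  have "null_sets lborel \<subseteq> null_sets (distr (lebesgue :: ('a \<times> 'a) measure) lborel fst)"
    "null_sets lborel \<subseteq> null_sets (distr (lebesgue :: ('a \<times> 'a) measure) lborel snd)"
    using vimage_null_sets_lborel_prod[where 'a='a, THEN null_sets_completionI]
    by (auto simp: null_sets_distr_iff[OF m(1)] null_sets_distr_iff[OF m(2)] dest: null_setsD2[of _ lborel, simplified])
  with m show "fst \<in> (lebesgue :: ('a \<times> 'a) measure) \<rightarrow>\<^sub>M lebesgue"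
    "snd \<in> (lebesgue :: ('a \<times> 'a) measure) \<rightarrow>\<^sub>M lebesgue"
    by (auto intro!: completion.measurable_completion2)
qed

lemma borel_measurable_lebesgue_fst_snd:
  assumes "f \<in> borel_measurable (lebesgue :: 'a::euclidean_space measure)"
  shows "(\<lambda>z. f (fst z)) \<in> borel_measurable (lebesgue :: ('a \<times> 'a) measure)"
    and "(\<lambda>z. f (snd z)) \<in> borel_measurable (lebesgue :: ('a \<times> 'a) measure)"
  using measurable_compose[OF measurable_lebesgue_fst_snd(1) assms]
    measurable_compose[OF measurable_lebesgue_fst_snd(2) assms] .

lemma AE_lebesgue_fst_snd:
  assumes "AE x in (lebesgue :: 'a::euclidean_space measure). P x"
  shows "AE z in (lebesgue :: ('a \<times> 'a) measure). P (fst z) \<and> P (snd z)"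
proof -
  from assms have "AE x in lborel. P x" by (simp add: AE_completion_iff)
  then obtain N where N: "{x \<in> space lborel. \<not> P x} \<subseteq> N" "N \<in> null_sets lborel"
    by (metis AE_E null_setsI)
  from vimage_null_sets_lborel_prod[OF N(2), THEN AE_not_in]
  have "AE z in (lborel :: ('a \<times> 'a) measure). P (fst z) \<and> P (snd z)"
    by eventually_elim (use N(1) in auto)
  then show ?thesis by (rule AE_completion)
qed

section \<open>Integrals and \<open>L\<^sup>2\<close> functions\<close>

lemma ext_lint_integrable:
  assumes "integrable M f"
  shows "ext_lint M f = ereal (\<integral>x. f x \<partial>M)"
proof -
  have m: "f \<in> borel_measurable M" using assms by auto
  have fin: "(\<integral>\<^sup>+ x. ennreal (f x) \<partial>M) < \<infinity>" "(\<integral>\<^sup>+ x. ennreal (- f x) \<partial>M) < \<infinity>"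
    using assms by (auto simp: real_integrable_def less_top)
  then obtain a b where "(\<integral>\<^sup>+ x. ennreal (f x) \<partial>M) = ennreal a" "0 \<le> a"
      "(\<integral>\<^sup>+ x. ennreal (- f x) \<partial>M) = ennreal b" "0 \<le> b"
    by (metis ennreal_cases infinity_ennreal_def less_irrefl)
  then show ?thesis
    using assms unfolding ext_lint_def by (simp add: real_lebesgue_integral_def enn2ereal_ennreal)
qed

lemma ext_lint_nonneg:
  assumes "\<And>x. 0 \<le> f x"
  shows "ext_lint M f = enn2ereal (\<integral>\<^sup>+ x. ennreal (f x) \<partial>M)"
  using assms unfolding ext_lint_def by (simp add: ennreal_neg zero_ennreal.rep_eq)

lemma ext_lint_nonneg_finite_imp_integrable:
  assumes "\<And>x. 0 \<le> f x" "f \<in> borel_measurable M" "ext_lint M f < \<infinity>"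
  shows "integrable M f"
proof (rule integrableI_nonneg)
  show "(\<integral>\<^sup>+ x. ennreal (f x) \<partial>M) < \<infinity>"
    using assms(3) unfolding ext_lint_nonneg[of f, OF assms(1)]
    by (metis enn2ereal_top infinity_ennreal_def less_irrefl top.not_eq_extremum)
qed (use assms in auto)

lemma abs_mult_le_sum_squares: "\<bar>a * b\<bar> \<le> a\<^sup>2 + b\<^sup>2" for a b :: real
proof -
  have "2 * \<bar>a * b\<bar> \<le> a\<^sup>2 + b\<^sup>2" "0 \<le> \<bar>a * b\<bar>"
    using sum_squares_bound[of "\<bar>a\<bar>" "\<bar>b\<bar>"] by (simp_all add: abs_mult mult.assoc)
  then show ?thesis by linarith
qed

lemma Lp_2_iff:
  "f \<in> Lp 2 \<longleftrightarrow> f \<in> borel_measurable lebesgue \<and> integrable lebesgue (\<lambda>x. (f x)\<^sup>2)"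
  by (simp add: Lp_def)

lemma lpnorm_2_eq: "lpnorm 2 f = sqrt (\<integral>x. (f x)\<^sup>2 \<partial>lebesgue)"
  by (simp add: lpnorm_def powr_half_sqrt)

lemma Lp_2_mult_integrable:
  assumes "f \<in> Lp 2" "g \<in> Lp 2"
  shows "integrable lebesgue (\<lambda>x. f x * g x)"
proof (rule Bochner_Integration.integrable_bound)
  show "integrable lebesgue (\<lambda>x. (f x)\<^sup>2 + (g x)\<^sup>2)"
    using assms by (auto simp: Lp_2_iff)
  show "AE x in lebesgue. norm (f x * g x) \<le> norm ((f x)\<^sup>2 + (g x)\<^sup>2)"
    using abs_mult_le_sum_squares by auto
qed (use assms in \<open>auto simp: Lp_2_iff\<close>)

lemma Lp_2_add:
  assumes "f \<in> Lp 2" "g \<in> Lp 2"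
  shows "(\<lambda>x. f x + g x) \<in> Lp 2"
  using assms Lp_2_mult_integrable[OF assms]
  by (auto simp: Lp_2_iff power2_sum mult.assoc)

lemma Lp_2_cmult:
  assumes "f \<in> Lp 2"
  shows "(\<lambda>x. c * f x) \<in> Lp 2"
  using assms by (auto simp: Lp_2_iff power_mult_distrib)

lemma Lp_2_diff:
  assumes "f \<in> Lp 2" "g \<in> Lp 2"
  shows "(\<lambda>x. f x - g x) \<in> Lp 2"
  using Lp_2_add[OF assms(1) Lp_2_cmult[OF assms(2), of "-1"]] by simp

text \<open>The integral of \<open>(a * f - b * g)\<close> squared is a nonnegative quadratic form
  in \<open>a\<close> and \<open>b\<close>; suitable values of \<open>a\<close> and \<open>b\<close>
  give the discriminant condition.\<close>

lemma Lp_2_Cauchy_Schwarz: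
  assumes f: "f \<in> Lp 2" and g: "g \<in> Lp 2"
  shows "\<bar>\<integral>x. f x * g x \<partial>lebesgue\<bar> \<le> lpnorm 2 f * lpnorm 2 g"
proof -
  let ?A = "\<integral>x. (f x)\<^sup>2 \<partial>lebesgue" and ?B = "\<integral>x. f x * g x \<partial>lebesgue"
    and ?C = "\<integral>x. (g x)\<^sup>2 \<partial>lebesgue"
  have i: "integrable lebesgue (\<lambda>x. (f x)\<^sup>2)" "integrable lebesgue (\<lambda>x. (g x)\<^sup>2)"
     "integrable lebesgue (\<lambda>x. f x * g x)"
    using f g Lp_2_mult_integrable[OF f g] by (auto simp: Lp_2_iff)
  have q: "0 \<le> a\<^sup>2 * ?A - 2 * a * b * ?B + b\<^sup>2 * ?C" for a b
  proof -
    have "0 \<le> (\<integral>x. (a * f x - b * g x)\<^sup>2 \<partial>lebesgue)" by simp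
    also have "\<dots> = (\<integral>x. a\<^sup>2 * (f x)\<^sup>2 - 2 * a * b * (f x * g x) + b\<^sup>2 * (g x)\<^sup>2 \<partial>lebesgue)"
      by (intro Bochner_Integration.integral_cong) (auto simp: power2_eq_square algebra_simps)
    also have "\<dots> = a\<^sup>2 * ?A - 2 * a * b * ?B + b\<^sup>2 * ?C"
      using i by simp
    finally show ?thesis .
  qed
  have AC: "0 \<le> ?A" "0 \<le> ?C" by simp_all
  have "?B\<^sup>2 \<le> ?A * ?C"
  proof (cases "?C = 0")
    case True
    have "?B = 0"
    proof (rule ccontr)
      assume B: "?B \<noteq> 0"
      \<comment> \<open>Without the quadratic term in \<open>b\<close> the form is linear in
        \<open>b\<close>; this \<open>b\<close> makes the cross term equal to
        \<open>- 2 * (?A + 1)\<close>, which outweighs \<open>?A\<close>.\<close>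
      have "0 \<le> 1\<^sup>2 * ?A - 2 * 1 * ((?A + 1) / ?B) * ?B + ((?A + 1) / ?B)\<^sup>2 * ?C" by (rule q)
      also have "\<dots> = - ?A - 2" using B True by simp
      finally show False using AC by simp
    qed
    then show ?thesis using AC by simp
  next
    case False
    have "0 \<le> ?C\<^sup>2 * ?A - 2 * ?C * ?B * ?B + ?B\<^sup>2 * ?C" by (rule q)
    also have "\<dots> = ?C * (?A * ?C - ?B\<^sup>2)" by (simp add: power2_eq_square algebra_simps)
    finally show ?thesis using False AC by (simp add: zero_le_mult_iff)
  qed
  then have "\<bar>?B\<bar> \<le> sqrt (?A * ?C)" by (simp add: real_le_rsqrt)
  then show ?thesis by (simp add: lpnorm_2_eq real_sqrt_mult)
qed

lemma lpnorm_nonneg [simp]: "0 \<le> lpnorm p f"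
  by (simp add: lpnorm_def)

text \<open>Joint continuity of the inner product: the difference splits into
  \<open>x * y + x * Y0 + X0 * y\<close> with \<open>x\<close>, \<open>y\<close> the increments, and
  Cauchy-Schwarz bounds each term. The filter is arbitrary so that one-sided and two-sided limits in
  time are both covered.\<close>

lemma tendsto_integral_mult_Lp_2:
  assumes X: "\<forall>\<^sub>F s in F. X s \<in> Lp 2" "X0 \<in> Lp 2" "((\<lambda>s. lpnorm 2 (\<lambda>x. X s x - X0 x)) \<longlongrightarrow> 0) F"
    and Y: "\<forall>\<^sub>F s in F. Y s \<in> Lp 2" "Y0 \<in> Lp 2" "((\<lambda>s. lpnorm 2 (\<lambda>x. Y s x - Y0 x)) \<longlongrightarrow> 0) F"
  shows "((\<lambda>s. \<integral>x. X s x * Y s x \<partial>lebesgue) \<longlongrightarrow> (\<integral>x. X0 x * Y0 x \<partial>lebesgue)) F"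
proof (rule LIM_zero_cancel, rule Lim_null_comparison)
  let ?nX = "\<lambda>s. lpnorm 2 (\<lambda>x. X s x - X0 x)" and ?nY = "\<lambda>s. lpnorm 2 (\<lambda>x. Y s x - Y0 x)"
  show "((\<lambda>s. ?nX s * ?nY s + ?nX s * lpnorm 2 Y0 + lpnorm 2 X0 * ?nY s) \<longlongrightarrow> 0) F"
    by (rule tendsto_eq_intros X Y refl | simp)+
  show "\<forall>\<^sub>F s in F. norm ((\<integral>x. X s x * Y s x \<partial>lebesgue) - (\<integral>x. X0 x * Y0 x \<partial>lebesgue))
      \<le> ?nX s * ?nY s + ?nX s * lpnorm 2 Y0 + lpnorm 2 X0 * ?nY s"
    using X(1) Y(1)
  proof eventually_elim
    case (elim s)
    let ?x = "\<lambda>x. X s x - X0 x" and ?y = "\<lambda>x. Y s x - Y0 x"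
    note d = Lp_2_diff[OF elim(1) X(2)] Lp_2_diff[OF elim(2) Y(2)]
    have "(\<integral>x. X s x * Y s x \<partial>lebesgue) - (\<integral>x. X0 x * Y0 x \<partial>lebesgue) =
        (\<integral>x. X s x * Y s x - X0 x * Y0 x \<partial>lebesgue)"
      using Lp_2_mult_integrable[OF elim] Lp_2_mult_integrable[OF X(2) Y(2)] by simp
    also have "\<dots> = (\<integral>x. ?x x * ?y x + ?x x * Y0 x + X0 x * ?y x \<partial>lebesgue)"
      by (intro Bochner_Integration.integral_cong) (auto simp: algebra_simps)
    also have "\<dots> = (\<integral>x. ?x x * ?y x \<partial>lebesgue) + (\<integral>x. ?x x * Y0 x \<partial>lebesgue)
        + (\<integral>x. X0 x * ?y x \<partial>lebesgue)"
      using Lp_2_mult_integrable[OF d] Lp_2_mult_integrable[OF d(1) Y(2)]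
        Lp_2_mult_integrable[OF X(2) d(2)] by simp
    finally show ?case
      using Lp_2_Cauchy_Schwarz[OF d] Lp_2_Cauchy_Schwarz[OF d(1) Y(2)]
        Lp_2_Cauchy_Schwarz[OF X(2) d(2)] unfolding real_norm_def by linarith
  qed
qed

section \<open>The energy and the semigroup near time zero\<close>

text \<open>The real-valued counterpart of \<open>form\<close>, with which one can compute in the
  reals. The two agree when the density is integrable, in particular on \<open>HL J\<close>;
  otherwise the Bochner integral takes its default value \<open>0\<close>.\<close>

definition energy :: "('a::euclidean_space \<Rightarrow> 'a \<Rightarrow> real) \<Rightarrow> ('a \<Rightarrow> real) \<Rightarrow> ('a \<Rightarrow> real) \<Rightarrow> real" where
  "energy J f g =
     (1/2) * (\<integral>(x, y). (f x - f y) * (g x - g y) * J x y \<partial>(lebesgue :: ('a \<times> 'a) measure))"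

context
  fixes J :: "'a::euclidean_space \<Rightarrow> 'a \<Rightarrow> real"
  assumes J: "levy_kernel J"
begin

lemma J_nonneg: "0 \<le> J x y"
  using J by (auto simp: levy_kernel_def)

lemma form_density_measurable:
  assumes "f \<in> borel_measurable lebesgue" "g \<in> borel_measurable lebesgue"
  shows "(\<lambda>(x, y). (f x - f y) * (g x - g y) * J x y) \<in> borel_measurable lebesgue"
proof -
  have [measurable]: "(\<lambda>z. J (fst z) (snd z)) \<in> borel_measurable lebesgue"
    using J by (simp add: levy_kernel_def split_beta')
  note [measurable] = borel_measurable_lebesgue_fst_snd[OF assms(1)]
    borel_measurable_lebesgue_fst_snd[OF assms(2)]
  show ?thesis by (simp add: split_beta')
qed

lemma form_density_self_integrable_iff:
  assumes "f \<in> borel_measurable lebesgue"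
  shows "form J f f < \<infinity> \<longleftrightarrow> integrable lebesgue (\<lambda>(x, y). (f x - f y) * (f x - f y) * J x y)"
proof
  assume "form J f f < \<infinity>"
  then have "ext_lint lebesgue (\<lambda>(x, y). (f x - f y) * (f x - f y) * J x y) < \<infinity>"
    unfolding form_def by (auto simp: less_top)
  then show "integrable lebesgue (\<lambda>(x, y). (f x - f y) * (f x - f y) * J x y)"
    by (intro ext_lint_nonneg_finite_imp_integrable)
      (use assms form_density_measurable in \<open>auto simp: J_nonneg\<close>)
next
  assume "integrable lebesgue (\<lambda>(x, y). (f x - f y) * (f x - f y) * J x y)"
  then show "form J f f < \<infinity>" unfolding form_def by (subst ext_lint_integrable) auto
qed

lemma HL_iff:
  "f \<in> HL J \<longleftrightarrow> f \<in> Lp 2 \<and> integrable lebesgue (\<lambda>(x, y). (f x - f y) * (f x - f y) * J x y)"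
  unfolding HL_def using form_density_self_integrable_iff by (auto simp: Lp_2_iff)

lemma HL_density_integrable:
  assumes f: "f \<in> HL J" and g: "g \<in> HL J"
  shows "integrable lebesgue (\<lambda>(x, y). (f x - f y) * (g x - g y) * J x y)"
proof (rule Bochner_Integration.integrable_bound)
  show "integrable lebesgue (\<lambda>z. (\<lambda>(x, y). (f x - f y) * (f x - f y) * J x y) z
      + (\<lambda>(x, y). (g x - g y) * (g x - g y) * J x y) z)"
    using f g by (intro Bochner_Integration.integrable_add) (auto simp: HL_iff)
  show "(\<lambda>(x, y). (f x - f y) * (g x - g y) * J x y) \<in> borel_measurable lebesgue"
    using f g by (intro form_density_measurable) (auto simp: HL_iff Lp_2_iff)
  have *: "\<bar>a * b * j\<bar> \<le> \<bar>a * a * j + b * b * j\<bar>" if "0 \<le> j" for a b j :: real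
  proof -
    have "\<bar>a * b\<bar> \<le> a * a + b * b"
      using abs_mult_le_sum_squares[of a b] by (simp add: power2_eq_square)
    from mult_right_mono[OF this that] show ?thesis using that
      by (simp add: abs_mult algebra_simps)
  qed
  then show "AE z in lebesgue. norm ((\<lambda>(x, y). (f x - f y) * (g x - g y) * J x y) z) \<le>
      norm ((\<lambda>(x, y). (f x - f y) * (f x - f y) * J x y) z
      + (\<lambda>(x, y). (g x - g y) * (g x - g y) * J x y) z)"
    by (auto simp: J_nonneg)
qed

lemma form_eq_energy:
  assumes "f \<in> HL J" "g \<in> HL J"
  shows "form J f g = ereal (energy J f g)"
  unfolding form_def energy_def using ext_lint_integrable[OF HL_density_integrable[OF assms]] by simp

lemma energy_add_cmult:
  assumes f: "f \<in> HL J" and g: "g \<in> HL J"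
  shows "(\<lambda>x. f x + c * g x) \<in> HL J"
    and "energy J (\<lambda>x. f x + c * g x) (\<lambda>x. f x + c * g x)
       = energy J f f + 2 * c * energy J f g + c\<^sup>2 * energy J g g"
proof -
  let ?d = "\<lambda>f g z. (\<lambda>(x, y). (f x - f y) * (g x - g y) * J x y) z"
  let ?h = "\<lambda>x. f x + c * g x"
  note i = HL_density_integrable[OF f f] HL_density_integrable[OF f g] HL_density_integrable[OF g g]
  have eq: "?d ?h ?h = (\<lambda>z. ?d f f z + 2 * c * ?d f g z + c\<^sup>2 * ?d g g z)"
    by (auto simp: fun_eq_iff algebra_simps power2_eq_square)
  have "?h \<in> Lp 2" using f g by (intro Lp_2_add Lp_2_cmult) (auto simp: HL_iff)
  moreover have "integrable lebesgue (?d ?h ?h)" unfolding eq using i by auto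
  ultimately show "?h \<in> HL J" by (simp add: HL_iff)
  show "energy J ?h ?h = energy J f f + 2 * c * energy J f g + c\<^sup>2 * energy J g g"
    unfolding energy_def eq using i by (simp add: algebra_simps)
qed

lemma energy_nonneg: "0 \<le> energy J f f"
  unfolding energy_def by (auto intro!: Bochner_Integration.integral_nonneg simp: J_nonneg)

lemma HL_diff:
  assumes f: "f \<in> HL J" and g: "g \<in> HL J"
  shows "(\<lambda>x. f x - g x) \<in> HL J"
  using energy_add_cmult(1)[OF assms, of "-1"] by simp

text \<open>The subgradient inequality of the convex functional \<open>energy J w w\<close>: expand
  it at \<open>w = u - (u - w)\<close> and drop the nonnegative energy of
  \<open>u - w\<close>.\<close>

lemma energy_diff_le:
  assumes u: "u \<in> HL J" and w: "w \<in> HL J"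
  shows "- 2 * energy J u (\<lambda>x. u x - w x) \<le> energy J w w - energy J u u"
  using energy_add_cmult(2)[OF u HL_diff[OF u w], of "-1"] energy_nonneg[of "\<lambda>x. u x - w x"]
  by simp

text \<open>The evolution variational inequality of the gradient flow of the energy, at one intermediate
  time: the mean value theorem applied to \<open>t \<mapsto> \<parallel>u t - w\<parallel>\<^sup>2\<close>.\<close>

lemma levy_solution_variational_inequality:
  assumes u: "levy_solution J f u" and f: "f \<in> Lp 2" and w: "w \<in> HL J" and t: "0 < t"
  obtains s where "0 < s" "s < t" "u s \<in> HL J"
    "(\<integral>x. (u t x - w x)\<^sup>2 \<partial>lebesgue) - (\<integral>x. (f x - w x)\<^sup>2 \<partial>lebesgue)
       \<le> t * (energy J w w - energy J (u s) (u s))"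
proof -
  from u obtain v where u0: "AE x in lebesgue. u 0 x = f x"
    and uL: "\<And>t. 0 \<le> t \<Longrightarrow> u t \<in> Lp 2"
    and uc: "\<And>t. 0 \<le> t \<Longrightarrow> ((\<lambda>s. lpnorm 2 (\<lambda>x. u s x - u t x)) \<longlongrightarrow> 0) (at t within {0..})"
    and uH: "\<And>t. 0 < t \<Longrightarrow> u t \<in> HL J"
    and vL: "\<And>t. 0 < t \<Longrightarrow> v t \<in> Lp 2"
    and vd: "\<And>t. 0 < t \<Longrightarrow> ((\<lambda>s. lpnorm 2 (\<lambda>x. (u s x - u t x) / (s - t) - v t x)) \<longlongrightarrow> 0) (at t)"
    and op: "\<And>t. 0 < t \<Longrightarrow> levy_op J (u t) (\<lambda>x. - v t x)"
    unfolding levy_solution_def by blast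
  have wL: "w \<in> Lp 2" using w by (simp add: HL_iff)
  define K where "K s = (\<integral>x. (u s x - w x) * (u s x - w x) \<partial>lebesgue)" for s
  have "continuous_on {0..t} K"
    unfolding continuous_on_def
  proof
    fix r assume r: "r \<in> {0..t}"
    have ev: "\<forall>\<^sub>F s in at r within {0..t}. (\<lambda>x. u s x - w x) \<in> Lp 2"
      unfolding eventually_at_filter by (auto intro!: always_eventually Lp_2_diff uL wL)
    have "((\<lambda>s. lpnorm 2 (\<lambda>x. u s x - u r x)) \<longlongrightarrow> 0) (at r within {0..t})"
      by (rule tendsto_within_subset[OF uc]) (use r in auto)
    then have "((\<lambda>s. lpnorm 2 (\<lambda>x. (u s x - w x) - (u r x - w x))) \<longlongrightarrow> 0) (at r within {0..t})"
      by simp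
    then show "(K \<longlongrightarrow> K r) (at r within {0..t})"
      unfolding K_def using ev r uL[of r] wL by (intro tendsto_integral_mult_Lp_2 Lp_2_diff) auto
  qed
  moreover have K': "(K has_real_derivative 2 * (\<integral>x. v r x * (u r x - w x) \<partial>lebesgue)) (at r)"
    if r: "0 < r" for r
  proof -
    have ev0: "\<forall>\<^sub>F s in at r. 0 < s"
      using eventually_at_in_open'[of "{0<..}" r] r by simp
    have "((\<lambda>s. lpnorm 2 (\<lambda>x. u s x - u r x)) \<longlongrightarrow> 0) (at r)"
      using uc[of r] r at_within_interior[of r "{0..}"] by simp
    then have c: "((\<lambda>s. lpnorm 2 (\<lambda>x. ((u s x - w x) + (u r x - w x)) - 2 * (u r x - w x))) \<longlongrightarrow> 0) (at r)"
      by (simp add: algebra_simps)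
    \<comment> \<open>A difference of squares factors, so the difference quotient of
      \<open>K\<close> pairs a quotient converging to \<open>v r\<close> with a sum converging to
      \<open>2 * (u r - w)\<close>, both in \<open>L^2\<close>.\<close>
    have lim: "((\<lambda>s. \<integral>x. ((u s x - u r x) / (s - r)) * ((u s x - w x) + (u r x - w x)) \<partial>lebesgue)
      \<longlongrightarrow> (\<integral>x. v r x * (2 * (u r x - w x)) \<partial>lebesgue)) (at r)"
    proof (rule tendsto_integral_mult_Lp_2[OF _ vL[OF r] vd[OF r] _ _ c])
      show "\<forall>\<^sub>F s in at r. (\<lambda>x. (u s x - u r x) / (s - r)) \<in> Lp 2"
        using ev0
      proof eventually_elim
        case (elim s)
        then show ?case
          using Lp_2_cmult[OF Lp_2_diff[OF uL uL], of s r "1 / (s - r)"] r by simp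
      qed
      show "\<forall>\<^sub>F s in at r. (\<lambda>x. (u s x - w x) + (u r x - w x)) \<in> Lp 2"
        using ev0 by eventually_elim (use r in \<open>intro Lp_2_add Lp_2_diff uL wL; simp\<close>)
      show "(\<lambda>x. 2 * (u r x - w x)) \<in> Lp 2" using r by (intro Lp_2_cmult Lp_2_diff uL wL) auto
    qed
    have eq: "\<forall>\<^sub>F s in at r. (K s - K r) / (s - r) =
      (\<integral>x. ((u s x - u r x) / (s - r)) * ((u s x - w x) + (u r x - w x)) \<partial>lebesgue)"
      using ev0
    proof eventually_elim
      case (elim s)
      have d: "(\<lambda>x. u s x - w x) \<in> Lp 2" "(\<lambda>x. u r x - w x) \<in> Lp 2"
        using elim r by (auto intro!: Lp_2_diff uL wL)
      have "(K s - K r) / (s - r) =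
        (\<integral>x. ((u s x - w x) * (u s x - w x) - (u r x - w x) * (u r x - w x)) / (s - r) \<partial>lebesgue)"
        unfolding K_def
        using Lp_2_mult_integrable[OF d(1) d(1)] Lp_2_mult_integrable[OF d(2) d(2)] by simp
      also have "\<dots> = (\<integral>x. ((u s x - u r x) / (s - r)) * ((u s x - w x) + (u r x - w x)) \<partial>lebesgue)"
        by (simp add: square_diff_square_factored mult.commute)
      finally show ?case .
    qed
    have "((\<lambda>s. (K s - K r) / (s - r)) \<longlongrightarrow> (\<integral>x. v r x * (2 * (u r x - w x)) \<partial>lebesgue)) (at r)"
      by (rule iffD2[OF tendsto_cong[OF eq] lim])
    moreover have "(\<integral>x. v r x * (2 * (u r x - w x)) \<partial>lebesgue) = 2 * (\<integral>x. v r x * (u r x - w x) \<partial>lebesgue)"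
      unfolding mult.left_commute[of _ 2] by (rule integral_mult_right_zero)
    ultimately show ?thesis unfolding has_field_derivative_iff by (simp only:)
  qed
  ultimately obtain l s where s: "0 < s" "s < t" "DERIV K s :> l" "K t - K 0 = (t - 0) * l"
    using MVT[OF t, of K] by (metis real_differentiable_def)
  \<comment> \<open>The weak equation is tested with \<open>u s - w\<close>. This identifies the
    derivative of \<open>K\<close> at \<open>s\<close> as
    \<open>- 2 * energy J (u s) (u s - w)\<close>, to which the subgradient inequality
    applies.\<close>
  have "(\<integral>x. - v s x * (u s x - w x) \<partial>lebesgue) = energy J (u s) (\<lambda>x. u s x - w x)"
    using op[OF s(1)] HL_diff[OF uH[OF s(1)] w] form_eq_energy[OF uH[OF s(1)] HL_diff[OF uH[OF s(1)] w]]
    unfolding levy_op_def by auto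
  then have "2 * (\<integral>x. v s x * (u s x - w x) \<partial>lebesgue) \<le> energy J w w - energy J (u s) (u s)"
    using energy_diff_le[OF uH[OF s(1)] w] by simp
  then have "K t - K 0 \<le> t * (energy J w w - energy J (u s) (u s))"
    using s(4) DERIV_unique[OF s(3) K'[OF s(1)]] t by (simp add: mult_left_mono)
  moreover have "K 0 = (\<integral>x. (f x - w x)\<^sup>2 \<partial>lebesgue)"
    unfolding K_def power2_eq_square
    using u0 uL[of 0] f wL by (intro integral_cong_AE) (auto simp: Lp_2_iff)
  ultimately show ?thesis
    using that[OF s(1,2) uH[OF s(1)]] by (simp add: K_def power2_eq_square)
qed

end

section \<open>Lower semicontinuity of the energy, and the solution as time tends to zero\<close>

context
  fixes J :: "'a::euclidean_space \<Rightarrow> 'a \<Rightarrow> real"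
  assumes J: "levy_kernel J"
begin

text \<open>Fatou's lemma on the product space, along a subsequence converging almost everywhere.
  The kernel is nonnegative, so the densities are too.\<close>

lemma energy_lower_semicontinuous:
  assumes f: "f \<in> Lp 2" and u: "\<And>n. u n \<in> HL J"
    and lim: "(\<lambda>n. lpnorm 2 (\<lambda>x. u n x - f x)) \<longlonglongrightarrow> 0"
    and c: "\<And>n. energy J (u n) (u n) \<le> c"
  shows "energy J f f \<le> c"
proof -
  note [simp] = J_nonneg[OF J]
  let ?d = "\<lambda>h z. (\<lambda>(x, y). (h x - h y) * (h x - h y) * J x y) z"
  have uL: "u n \<in> Lp 2" for n using u HL_iff[OF J] by auto
  have c0: "0 \<le> c" using c[of 0] energy_nonneg[OF J, of "u 0"] by linarith
  have int: "integrable lebesgue (\<lambda>x. (u n x - f x)\<^sup>2)" for n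
    using Lp_2_diff[OF uL f] by (simp add: Lp_2_iff)
  have "(\<lambda>n. (lpnorm 2 (\<lambda>x. u n x - f x))\<^sup>2) \<longlonglongrightarrow> 0\<^sup>2" by (intro tendsto_intros lim)
  then have "(\<lambda>n. \<integral>x. norm ((u n x - f x)\<^sup>2) \<partial>lebesgue) \<longlonglongrightarrow> 0"
    by (simp add: lpnorm_2_eq)
  \<comment> \<open>Convergence in \<open>L^2\<close> is convergence in \<open>L^1\<close> of the
    squared differences, which yields the subsequence.\<close>
  from tendsto_L1_AE_subseq[OF int this]
  obtain r where r: "strict_mono r" "AE x in lebesgue. (\<lambda>n. (u (r n) x - f x)\<^sup>2) \<longlonglongrightarrow> 0"
    by auto
  have ae: "AE x in lebesgue. (\<lambda>n. u (r n) x) \<longlonglongrightarrow> f x"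
    using r(2)
  proof eventually_elim
    case (elim x)
    have "(\<lambda>n. sqrt ((u (r n) x - f x)\<^sup>2)) \<longlonglongrightarrow> sqrt 0" by (intro tendsto_intros elim)
    then have "(\<lambda>n. u (r n) x - f x) \<longlonglongrightarrow> 0" by (simp add: tendsto_rabs_zero_iff)
    then show ?case by (rule LIM_zero_cancel)
  qed
  have "AE z in lebesgue. (\<lambda>n. ?d (u (r n)) z) \<longlonglongrightarrow> ?d f z"
    using AE_lebesgue_fst_snd[OF ae]
    by eventually_elim (auto simp: split_beta intro!: tendsto_intros)
  then have lim': "AE z in lebesgue. ennreal (?d f z) = liminf (\<lambda>n. ennreal (?d (u (r n)) z))"
    by eventually_elim (auto intro!: lim_imp_Liminf[symmetric] tendsto_ennrealI)
  have "(\<integral>\<^sup>+ z. ennreal (?d f z) \<partial>lebesgue) = (\<integral>\<^sup>+ z. liminf (\<lambda>n. ennreal (?d (u (r n)) z)) \<partial>lebesgue)"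
    by (rule nn_integral_cong_AE) (rule lim')
  also have "\<dots> \<le> liminf (\<lambda>n. \<integral>\<^sup>+ z. ennreal (?d (u (r n)) z) \<partial>lebesgue)"
    using uL by (intro nn_integral_liminf measurable_compose[OF form_density_measurable[OF J] measurable_ennreal])
      (auto simp: Lp_2_iff)
  also have "\<dots> \<le> limsup (\<lambda>n. \<integral>\<^sup>+ z. ennreal (?d (u (r n)) z) \<partial>lebesgue)"
    by (rule Liminf_le_Limsup) simp
  also have "\<dots> \<le> ennreal (2 * c)"
  proof (rule Limsup_bounded, rule always_eventually, rule allI)
    fix n
    have "(\<integral>\<^sup>+ z. ennreal (?d (u (r n)) z) \<partial>lebesgue) = ennreal (\<integral>z. ?d (u (r n)) z \<partial>lebesgue)"
      by (rule nn_integral_eq_integral) (use u HL_iff[OF J] in auto)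
    also have "\<dots> \<le> ennreal (2 * c)"
      using c[of "r n"] unfolding energy_def by (intro ennreal_leI) simp
    finally show "(\<integral>\<^sup>+ z. ennreal (?d (u (r n)) z) \<partial>lebesgue) \<le> ennreal (2 * c)" .
  qed
  finally have le: "(\<integral>\<^sup>+ z. ennreal (?d f z) \<partial>lebesgue) \<le> ennreal (2 * c)" .
  have "(\<integral>z. ?d f z \<partial>lebesgue) = enn2real (\<integral>\<^sup>+ z. ennreal (?d f z) \<partial>lebesgue)"
    using f by (intro integral_eq_nn_integral form_density_measurable[OF J]) (auto simp: Lp_2_iff)
  also have "\<dots> \<le> 2 * c"
    using c0 by (intro enn2real_leI le) auto
  finally show ?thesis unfolding energy_def by simp
qed

lemma levy_solution_tendsto_initial:
  assumes u: "levy_solution J f u" and f: "f \<in> Lp 2"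
  shows "((\<lambda>s. lpnorm 2 (\<lambda>x. u s x - f x)) \<longlongrightarrow> 0) (at_right 0)"
proof -
  from u have u0: "AE x in lebesgue. u 0 x = f x" and uL: "\<And>t. 0 \<le> t \<Longrightarrow> u t \<in> Lp 2"
    and "((\<lambda>s. lpnorm 2 (\<lambda>x. u s x - u 0 x)) \<longlongrightarrow> 0) (at 0 within {0..})"
    unfolding levy_solution_def by auto
  from this(3) have l: "((\<lambda>s. lpnorm 2 (\<lambda>x. u s x - u 0 x)) \<longlongrightarrow> 0) (at_right 0)"
    by (rule tendsto_within_subset) auto
  have eq: "\<forall>\<^sub>F s in at_right 0. lpnorm 2 (\<lambda>x. u s x - u 0 x) = lpnorm 2 (\<lambda>x. u s x - f x)"
    using eventually_at_right_less[of "0::real"]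
  proof eventually_elim
    case (elim s)
    show ?case unfolding lpnorm_2_eq
      using u0 uL[of s] uL[of 0] f elim
      by (intro arg_cong[of _ _ sqrt] integral_cong_AE) (auto simp: Lp_2_iff)
  qed
  from l show ?thesis by (simp add: tendsto_cong[OF eq])
qed

text \<open>Otherwise there are times tending to \<open>0\<close> at which the energy is at most
  \<open>c\<close>; the solution converges to \<open>f\<close> in \<open>L^2\<close> along them, and
  lower semicontinuity contradicts \<open>c < energy J f f\<close>.\<close>

lemma energy_eventually_gt:
  assumes u: "levy_solution J f u" and f: "f \<in> HL J" and c: "c < energy J f f"
  shows "\<forall>\<^sub>F s in at_right 0. c < energy J (u s) (u s)"
proof (rule ccontr)
  assume "\<not> ?thesis"
  then have "\<exists>s. 0 < s \<and> s < inverse (real (Suc n)) \<and> energy J (u s) (u s) \<le> c" for n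
    unfolding eventually_at_right_field by (metis inverse_positive_iff_positive not_le of_nat_0_less_iff zero_less_Suc)
  then obtain s where s: "\<And>n. 0 < s n" "\<And>n. s n < inverse (real (Suc n))"
    "\<And>n. energy J (u (s n)) (u (s n)) \<le> c" by metis
  have fL: "f \<in> Lp 2" using f HL_iff[OF J] by auto
  have "s \<longlonglongrightarrow> 0"
    by (rule tendsto_sandwich[OF _ _ tendsto_const LIMSEQ_inverse_real_of_nat])
      (use s in \<open>auto intro!: always_eventually less_imp_le\<close>)
  then have "filterlim s (at_right 0) sequentially"
    using s(1) by (auto simp: filterlim_at intro!: always_eventually) (metis less_irrefl)
  from filterlim_compose[OF levy_solution_tendsto_initial[OF u fL] this]
  have "(\<lambda>n. lpnorm 2 (\<lambda>x. u (s n) x - f x)) \<longlonglongrightarrow> 0" .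
  moreover have "u (s n) \<in> HL J" for n using u s(1) unfolding levy_solution_def by auto
  ultimately have "energy J f f \<le> c"
    using energy_lower_semicontinuous[OF fL, of "\<lambda>n. u (s n)"] s(3) by blast
  with c show False by simp
qed

text \<open>Only this one-sided bound on the derivative at \<open>0\<close> is needed; testing the variational
  inequality with \<open>f + \<epsilon> g\<close> avoids proving strong continuity of the semigroup in the form domain.\<close>

lemma levy_solution_pairing_upper:
  assumes u: "levy_solution J f u" and f: "f \<in> HL J" and g: "g \<in> HL J" and B: "energy J f g < B"
  shows "\<forall>\<^sub>F t in at_right 0. (\<integral>x. f x * g x \<partial>lebesgue) - (\<integral>x. u t x * g x \<partial>lebesgue) \<le> t * B"
proof -
  let ?G = "energy J g g + 1" and ?E = "energy J f g"
  have G: "0 < ?G" using energy_nonneg[OF J, of g] by linarith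
  \<comment> \<open>The error in the estimate below is \<open>e / 2 * ?G\<close>, and
    \<open>e\<close> makes it exactly \<open>B - ?E\<close>. The summand \<open>1\<close> in
    \<open>?G\<close> pays for the loss \<open>e^2\<close> allowed in the energy of
    \<open>u s\<close>.\<close>
  define e where "e = 2 * (B - ?E) / ?G"
  have e: "0 < e" using G B by (simp add: e_def)
  have B_eq: "?E + e / 2 * ?G = B" using G by (simp add: e_def field_simps)
  have L: "f \<in> Lp 2" "g \<in> Lp 2" using f g HL_iff[OF J] by auto
  have "\<forall>\<^sub>F s in at_right 0. energy J f f - e\<^sup>2 < energy J (u s) (u s)"
    by (rule energy_eventually_gt[OF u f]) (use e in auto)
  from this[unfolded eventually_at_right_field]
  obtain d where d: "0 < d" "\<And>s. 0 < s \<Longrightarrow> s < d \<Longrightarrow> energy J f f - e\<^sup>2 < energy J (u s) (u s)"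
    by blast
  let ?w = "\<lambda>x. f x + e * g x"
  have key: "(\<integral>x. f x * g x \<partial>lebesgue) - (\<integral>x. u t x * g x \<partial>lebesgue) \<le> t * B" if t: "0 < t" "t < d" for t
  proof -
    obtain s where s: "0 < s" "s < t" "u s \<in> HL J"
      "(\<integral>x. (u t x - ?w x)\<^sup>2 \<partial>lebesgue) - (\<integral>x. (f x - ?w x)\<^sup>2 \<partial>lebesgue)
        \<le> t * (energy J ?w ?w - energy J (u s) (u s))"
      by (rule levy_solution_variational_inequality[OF J u L(1) energy_add_cmult(1)[OF J f g] t(1)]) (rule that)
    have uL: "u t \<in> Lp 2" using u t unfolding levy_solution_def by auto
    note m = Lp_2_mult_integrable[OF Lp_2_diff[OF uL L(1)] Lp_2_diff[OF uL L(1)]]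
      Lp_2_mult_integrable[OF uL L(2)] Lp_2_mult_integrable[OF L] Lp_2_mult_integrable[OF L(2) L(2)]
    \<comment> \<open>With \<open>?w = f + e * g\<close>, the difference of
      \<open>\<parallel>u t - ?w\<parallel>^2\<close> and
      \<open>\<parallel>f - ?w\<parallel>^2\<close> is
      \<open>\<parallel>u t - f\<parallel>^2\<close> plus \<open>2 * e\<close> times the wanted
      pairing; the first term is nonnegative.\<close>
    have "2 * e * ((\<integral>x. f x * g x \<partial>lebesgue) - (\<integral>x. u t x * g x \<partial>lebesgue))
      \<le> (\<integral>x. (u t x - f x) * (u t x - f x) \<partial>lebesgue) + 2 * e * ((\<integral>x. f x * g x \<partial>lebesgue)
        - (\<integral>x. u t x * g x \<partial>lebesgue))" by (simp add: Bochner_Integration.integral_nonneg)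
    also have "\<dots> = (\<integral>x. (u t x - f x) * (u t x - f x) + (2 * e) * (f x * g x - u t x * g x)
        + e\<^sup>2 * (g x * g x) \<partial>lebesgue) - (\<integral>x. e\<^sup>2 * (g x * g x) \<partial>lebesgue)"
      using m by simp
    also have "\<dots> = (\<integral>x. (u t x - ?w x)\<^sup>2 \<partial>lebesgue) - (\<integral>x. (f x - ?w x)\<^sup>2 \<partial>lebesgue)"
      by (intro arg_cong2[where f="(-)"] Bochner_Integration.integral_cong)
        (auto simp: power2_eq_square algebra_simps)
    also have "\<dots> \<le> t * (energy J ?w ?w - energy J (u s) (u s))" by (rule s(4))
    also have "\<dots> \<le> t * (energy J ?w ?w - (energy J f f - e\<^sup>2))"
      using d(2)[of s] s t by (intro mult_left_mono) auto
    also have "\<dots> = 2 * e * (t * (?E + e / 2 * ?G))"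
      unfolding energy_add_cmult(2)[OF J f g] by (simp add: power2_eq_square field_simps)
    also have "\<dots> = 2 * e * (t * B)" unfolding B_eq ..
    finally show ?thesis using e by simp
  qed
  then show ?thesis unfolding eventually_at_right_field using d(1) by blast
qed

end

text \<open>Normal contractions preserve the form domain, since both integrands for \<open>g\<close>
  are dominated by \<open>K^2\<close> times those for \<open>f\<close>. This serves for signed
  powers of bounded functions and for truncations.\<close>

lemma HL_Lipschitz_comp:
  assumes J: "levy_kernel J" and f: "f \<in> HL J" and g: "g \<in> borel_measurable lebesgue"
    and bd: "\<And>x. \<bar>g x\<bar> \<le> K * \<bar>f x\<bar>" and lip: "\<And>x y. \<bar>g x - g y\<bar> \<le> K * \<bar>f x - f y\<bar>"
  shows "g \<in> HL J"
proof -
  have sq: "b\<^sup>2 \<le> K\<^sup>2 * a\<^sup>2" if "\<bar>b\<bar> \<le> K * \<bar>a\<bar>" for a b :: real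
    using power_mono[OF that, of 2] by (simp add: power_mult_distrib)
  from f have fL: "f \<in> Lp 2" and fi: "integrable lebesgue (\<lambda>(x, y). (f x - f y) * (f x - f y) * J x y)"
    by (simp_all add: HL_iff[OF J])
  have "integrable lebesgue (\<lambda>x. (g x)\<^sup>2)"
    by (rule Bochner_Integration.integrable_bound[where f = "\<lambda>x. K\<^sup>2 * (f x)\<^sup>2"])
      (use fL g bd sq in \<open>auto simp: Lp_2_iff\<close>)
  moreover have "integrable lebesgue (\<lambda>(x, y). (g x - g y) * (g x - g y) * J x y)"
  proof (rule Bochner_Integration.integrable_bound)
    show "integrable lebesgue (\<lambda>z. K\<^sup>2 * (\<lambda>(x, y). (f x - f y) * (f x - f y) * J x y) z)"
      using fi by (rule integrable_mult_right)
    show "(\<lambda>(x, y). (g x - g y) * (g x - g y) * J x y) \<in> borel_measurable lebesgue"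
      by (rule form_density_measurable[OF J g g])
    have "(g x - g y) * (g x - g y) * J x y \<le> K\<^sup>2 * ((f x - f y) * (f x - f y) * J x y)" for x y
      using mult_right_mono[OF sq[OF lip[of x y]] J_nonneg[OF J, of x y]]
      by (simp add: power2_eq_square mult.assoc)
    then show "AE z in lebesgue. norm ((\<lambda>(x, y). (g x - g y) * (g x - g y) * J x y) z) \<le>
        norm (K\<^sup>2 * (\<lambda>(x, y). (f x - f y) * (f x - f y) * J x y) z)"
      by (auto simp: J_nonneg[OF J] abs_mult)
  qed
  ultimately show ?thesis using g by (simp add: HL_iff[OF J] Lp_2_iff)
qed

section \<open>Powers and the entropy as a derivative\<close>

text \<open>The derivative of \<open>\<bar>a\<bar> powr p / p\<close>, that is, the unnormalised
  duality map of \<open>L^p\<close> in scalar form.\<close>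

definition signed_powr :: "real \<Rightarrow> real \<Rightarrow> real" where
  "signed_powr p a = \<bar>a\<bar> powr (p - 2) * a"

lemma signed_powr_measurable [measurable]: "signed_powr p \<in> borel_measurable borel"
  unfolding signed_powr_def[abs_def] by measurable

lemma signed_powr_nonneg_eq:
  assumes "0 \<le> a" "2 \<le> p"
  shows "signed_powr p a = a powr (p - 1)"
proof (cases "a = 0")
  case False
  then have "a powr (p - 2) * a powr 1 = a powr (p - 1)" by (simp only: powr_add[symmetric]) simp
  then show ?thesis using assms False by (simp add: signed_powr_def)
qed (use assms in \<open>simp add: signed_powr_def\<close>)

lemma signed_powr_minus: "signed_powr p (- a) = - signed_powr p a"
  by (simp add: signed_powr_def)

lemma abs_signed_powr:
  assumes "2 \<le> p"
  shows "\<bar>signed_powr p a\<bar> = \<bar>a\<bar> powr (p - 1)"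
proof -
  have "\<bar>signed_powr p a\<bar> = signed_powr p \<bar>a\<bar>" by (simp add: signed_powr_def abs_mult)
  then show ?thesis using assms by (simp add: signed_powr_nonneg_eq)
qed

lemma mult_signed_powr: "a * signed_powr p a = \<bar>a\<bar> powr p"
proof (cases "a = 0")
  case False
  then have "\<bar>a\<bar> powr (p - 2) * \<bar>a\<bar> powr 2 = \<bar>a\<bar> powr p" by (simp only: powr_add[symmetric]) simp
  then show ?thesis using False by (simp add: signed_powr_def power2_eq_square mult.commute mult.left_commute)
qed (simp add: signed_powr_def)

lemma signed_powr_mono:
  assumes "2 \<le> p" "a \<le> b"
  shows "signed_powr p a \<le> signed_powr p b"
proof -
  consider "0 \<le> a" | "b \<le> 0" | "a \<le> 0" "0 \<le> b" by linarith
  then show ?thesis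
  proof cases
    case 1
    then show ?thesis using assms by (simp add: signed_powr_nonneg_eq powr_mono2)
  next
    case 2
    have "signed_powr p (- b) \<le> signed_powr p (- a)"
      using assms 2 by (simp add: signed_powr_nonneg_eq powr_mono2)
    then show ?thesis by (simp add: signed_powr_minus)
  next
    case 3
    then show ?thesis by (simp add: signed_powr_def)
      (meson mult_nonneg_nonneg mult_nonneg_nonpos order_trans powr_ge_zero)
  qed
qed

text \<open>The mean value theorem applies on the nonnegative half-line; oddness covers the negative
  one, and an interval containing \<open>0\<close> is split there.\<close>

lemma signed_powr_Lipschitz:
  assumes p: "2 \<le> p" and M: "\<bar>a\<bar> \<le> M" "\<bar>b\<bar> \<le> M"
  shows "\<bar>signed_powr p a - signed_powr p b\<bar> \<le> (p - 1) * M powr (p - 2) * \<bar>a - b\<bar>"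
proof -
  let ?K = "(p - 1) * M powr (p - 2)"
  have pos: "signed_powr p y - signed_powr p x \<le> ?K * (y - x)" if "0 \<le> x" "x \<le> y" "y \<le> M" for x y
  proof (cases "x = y")
    case False
    then have "x < y" using that by simp
    have "continuous_on {x..y} (\<lambda>x. x powr (p - 1))"
      using that p by (intro continuous_on_powr' continuous_intros) auto
    moreover have "(\<lambda>x. x powr (p - 1)) differentiable (at z)" if "x < z" "z < y" for z
      unfolding real_differentiable_def
      using has_real_derivative_powr[of z "p - 1"] that \<open>0 \<le> x\<close> by fastforce
    ultimately obtain l z where z: "x < z" "z < y" "DERIV (\<lambda>x. x powr (p - 1)) z :> l"
      "y powr (p - 1) - x powr (p - 1) = (y - x) * l"
      using MVT[OF \<open>x < y\<close>, of "\<lambda>x. x powr (p - 1)"] by blast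
    have "0 < z" using z that by linarith
    from DERIV_unique[OF z(3) has_real_derivative_powr[OF this]]
    have l: "l = (p - 1) * z powr (p - 2)" by simp
    have "z powr (p - 2) \<le> M powr (p - 2)"
      using z that p \<open>0 < z\<close> by (intro powr_mono2) auto
    then have "l \<le> ?K" unfolding l using p by (intro mult_left_mono) auto
    then have "(y - x) * l \<le> (y - x) * ?K" using that by (intro mult_left_mono) auto
    then show ?thesis using z(4) that p by (simp add: signed_powr_nonneg_eq mult.commute)
  qed simp
  have zero [simp]: "signed_powr p 0 = 0" by (simp add: signed_powr_def)
  have main: "\<bar>signed_powr p y - signed_powr p x\<bar> \<le> ?K * \<bar>y - x\<bar>" if "x \<le> y" "\<bar>x\<bar> \<le> M" "\<bar>y\<bar> \<le> M" for x y
  proof -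
    consider "0 \<le> x" | "y \<le> 0" | "x \<le> 0" "0 \<le> y" by linarith
    then have "signed_powr p y - signed_powr p x \<le> ?K * (y - x)"
    proof cases
      case 1
      then show ?thesis using pos[of x y] that by simp
    next
      case 2
      then show ?thesis using pos[of "- y" "- x"] that by (simp add: signed_powr_minus)
    next
      case 3
      then show ?thesis using pos[of 0 y] pos[of 0 "- x"] that
        by (simp add: signed_powr_minus algebra_simps)
    qed
    moreover have "0 \<le> signed_powr p y - signed_powr p x"
      using signed_powr_mono[OF p \<open>x \<le> y\<close>] by simp
    ultimately show ?thesis using that by simp
  qed
  show ?thesis
    using main[of a b] main[of b a] M by (cases "a \<le> b") (auto simp: abs_minus_commute)
qed

text \<open>A bound linear in \<open>a\<close> and uniform in the exponent, to serve as dominating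
  function. For \<open>a < 1\<close> half a power is spent on the logarithm, whence the threshold
  \<open>3/2 = 1 + 1/2\<close>; for \<open>a \<ge> 1\<close> one uses
  \<open>ln a \<le> a\<close>.\<close>

lemma powr_mult_abs_ln_le:
  fixes a M r p :: real
  assumes "0 \<le> a" "a \<le> M" "3/2 \<le> r" "r \<le> p"
  shows "\<bar>a powr r * ln a\<bar> \<le> (M powr p + 2) * a"
proof -
  consider "a = 0" | "0 < a" "a < 1" | "1 \<le> a" using assms by linarith
  then show ?thesis
  proof cases
    case 2
    have "ln (1 / a) \<le> (1 / a) powr (1/2) / (1/2)"
      using 2 by (intro ln_powr_bound) auto
    then have "- ln a \<le> 2 * a powr (- (1/2))"
      using 2 by (simp add: ln_div powr_divide powr_minus_divide)
    moreover have "ln a \<le> 0" using 2 by simp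
    ultimately have l: "\<bar>ln a\<bar> \<le> 2 * a powr (- (1/2))" by linarith
    have "a powr r \<le> a powr (3/2)" using 2 assms by (intro powr_mono') auto
    then have "a powr r * \<bar>ln a\<bar> \<le> a powr (3/2) * (2 * a powr (- (1/2)))"
      using l by (intro mult_mono) auto
    also have "\<dots> = 2 * a"
      using 2 powr_add[of a "3/2" "- (1/2)"] by simp
    also have "\<dots> \<le> (M powr p + 2) * a" using 2 by (intro mult_right_mono) auto
    finally show ?thesis by (simp add: abs_mult)
  next
    case 3
    have "a powr r \<le> a powr p" using 3 assms by (intro powr_mono) auto
    also have "\<dots> \<le> M powr p" using assms by (intro powr_mono2) auto
    finally have *: "a powr r \<le> M powr p + 2" by simp
    have "ln a \<le> a" "0 \<le> ln a" using 3 ln_le_minus_one[of a] by auto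
    then have "a powr r * ln a \<le> (M powr p + 2) * a" using * 3 by (intro mult_mono) auto
    then show ?thesis using \<open>0 \<le> ln a\<close> by simp
  qed simp
qed

section \<open>Integrals of powers of a bounded function and their dependence on the
  exponent\<close>

context
  fixes a :: "'b \<Rightarrow> real" and M p :: real and \<mu> :: "'b measure"
  assumes a: "integrable \<mu> a" "\<And>x. 0 \<le> a x" "\<And>x. a x \<le> M" and p: "2 \<le> p"
begin

lemma bounded_powr_integrable:
  assumes "1 \<le> r"
  shows "integrable \<mu> (\<lambda>x. a x powr r)"
proof (rule Bochner_Integration.integrable_bound)
  show "integrable \<mu> (\<lambda>x. M powr (r - 1) * a x)" using a(1) by simp
  have "a x powr r \<le> M powr (r - 1) * a x" for x
  proof (cases "a x = 0")
    case False
    then have "a x powr (r - 1) * a x powr 1 = a x powr r" by (simp only: powr_add[symmetric]) simp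
    then have "a x powr r = a x powr (r - 1) * a x" using False a(2)[of x] by simp
    also have "\<dots> \<le> M powr (r - 1) * a x"
      using a(2,3)[of x] assms by (intro mult_right_mono powr_mono2) auto
    finally show ?thesis .
  qed simp
  then show "AE x in \<mu>. norm (a x powr r) \<le> norm (M powr (r - 1) * a x)"
    using a(2) by auto
qed (use a(1) in measurable)

lemma bounded_powr_ln_integrable:
  assumes "3/2 \<le> r" "r \<le> p"
  shows "integrable \<mu> (\<lambda>x. a x powr r * ln (a x))"
proof (rule Bochner_Integration.integrable_bound)
  show "integrable \<mu> (\<lambda>x. (M powr p + 2) * a x)" using a(1) by simp
  show "AE x in \<mu>. norm (a x powr r * ln (a x)) \<le> norm ((M powr p + 2) * a x)"
    using powr_mult_abs_ln_le[OF a(2,3) assms] a(2) by (auto simp: abs_mult)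
qed (use a(1) in measurable)

text \<open>Dominated convergence. The limit is one-sided because the exponents to be inserted
  approach \<open>p\<close> from below.\<close>

lemma continuous_integral_powr_ln:
  "continuous (at p within {3/2..p}) (\<lambda>r. \<integral>x. a x powr r * ln (a x) \<partial>\<mu>)"
  unfolding continuous_within tendsto_at_iff_sequentially comp_def
proof (intro allI impI)
  fix X :: "nat \<Rightarrow> real" assume X: "\<forall>i. X i \<in> {3/2..p} - {p}" "X \<longlonglongrightarrow> p"
  show "(\<lambda>n. \<integral>x. a x powr X n * ln (a x) \<partial>\<mu>) \<longlonglongrightarrow> (\<integral>x. a x powr p * ln (a x) \<partial>\<mu>)"
  proof (rule integral_dominated_convergence)
    show "integrable \<mu> (\<lambda>x. (M powr p + 2) * a x)" using a(1) by simp
    show "AE x in \<mu>. norm (a x powr X n * ln (a x)) \<le> (M powr p + 2) * a x" for n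
      using powr_mult_abs_ln_le[OF a(2,3), of "X n" p] X(1) by auto
    have "(\<lambda>n. a x powr X n * ln (a x)) \<longlonglongrightarrow> a x powr p * ln (a x)" for x
      by (cases "a x = 0") (auto intro!: tendsto_intros X(2))
    then show "AE x in \<mu>. (\<lambda>n. a x powr X n * ln (a x)) \<longlonglongrightarrow> a x powr p * ln (a x)" by simp
  qed (use a(1) in measurable)
qed

text \<open>The tangent inequality \<open>1 + y \<le> exp y\<close> with
  \<open>y = (p - r) * ln (a x)\<close>. It replaces differentiation under the integral sign; the
  logarithmic integral appears at \<open>r\<close>, and continuity later moves it to
  \<open>p\<close>.\<close>

lemma integral_powr_convex_bound:
  assumes "3/2 \<le> r" "r \<le> p"
  shows "(\<integral>x. a x powr r \<partial>\<mu>) \<le> (\<integral>x. a x powr p \<partial>\<mu>) - (p - r) * (\<integral>x. a x powr r * ln (a x) \<partial>\<mu>)"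
proof -
  have "a x powr r \<le> a x powr p - (p - r) * (a x powr r * ln (a x))" for x
  proof (cases "a x = 0")
    case False
    then have "0 < a x" using a(2)[of x] by simp
    have "a x powr r * (1 + (p - r) * ln (a x)) \<le> a x powr r * exp ((p - r) * ln (a x))"
      by (intro mult_left_mono exp_ge_add_one_self) auto
    also have "\<dots> = a x powr p" using False by (simp add: powr_def mult_exp_exp algebra_simps)
    finally show ?thesis by (simp add: algebra_simps)
  qed simp
  then have "(\<integral>x. a x powr r \<partial>\<mu>) \<le> (\<integral>x. a x powr p - (p - r) * (a x powr r * ln (a x)) \<partial>\<mu>)"
    using assms p bounded_powr_integrable bounded_powr_ln_integrable
    by (intro integral_mono Bochner_Integration.integrable_diff integrable_mult_right) auto
  also have "\<dots> = (\<integral>x. a x powr p \<partial>\<mu>) - (p - r) * (\<integral>x. a x powr r * ln (a x) \<partial>\<mu>)"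
    using bounded_powr_integrable[of p] bounded_powr_ln_integrable[OF assms] p by simp
  finally show ?thesis .
qed

text \<open>The exponent \<open>(p - 1) * (q / (q - 1))\<close> is \<open>p\<close> at time \<open>0\<close>, and the normalisation makes both sides of
  the hypothesis on \<open>A\<close> equal to \<open>1\<close> there, so the inequality passes to derivatives.\<close>

lemma derivative_ge_of_Hoelder_defect:
  fixes q A :: "real \<Rightarrow> real" and A' :: ereal
  assumes a_p: "(\<integral>x. a x powr p \<partial>\<mu>) = 1"
    and q: "((\<lambda>t. (q t - p) / t) \<longlongrightarrow> q1) (at_right 0)" "\<forall>\<^sub>F t in at_right 0. p \<le> q t"
    and A: "(A \<longlongrightarrow> 1) (at_right 0)" "((\<lambda>h. ereal ((A h - 1) / h)) \<longlongrightarrow> A') (at_right 0)"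
    and le: "\<forall>\<^sub>F t in at_right 0. 1 - t * b \<le>
      A t * (1 / q t + (1 - 1 / q t) * (\<integral>x. a x powr ((p - 1) * (q t / (q t - 1))) \<partial>\<mu>))"
  shows "ereal (q1 / p * (\<integral>x. a x powr p * ln (a x) \<partial>\<mu>) - b) \<le> A'"
proof -
  define r where "r t = (p - 1) * (q t / (q t - 1))" for t
  define L where "L s = (\<integral>x. a x powr s * ln (a x) \<partial>\<mu>)" for s
  \<comment> \<open>\<open>1 - k t\<close> will bound the factor multiplying \<open>A t\<close> from
    above, and \<open>k t / t\<close> carries the entropy term in the limit.\<close>
  define k where "k t = (q t - p) / q t * L (r t)" for t
  have t0: "((\<lambda>t. t) \<longlongrightarrow> (0::real)) (at_right 0)" by (rule tendsto_ident_at)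
  have lim0: "((\<lambda>t. p + t * ((q t - p) / t)) \<longlongrightarrow> p + 0 * q1) (at_right 0)"
    by (intro tendsto_intros t0 q(1))
  have ev: "\<forall>\<^sub>F t in at_right 0. p + t * ((q t - p) / t) = q t"
    using eventually_at_right_less[of "0::real"] by eventually_elim auto
  have qp: "(q \<longlongrightarrow> p) (at_right 0)" using tendsto_cong[THEN iffD1, OF ev lim0] by simp
  have "(r \<longlongrightarrow> (p - 1) * (p / (p - 1))) (at_right 0)"
    unfolding r_def using p by (intro tendsto_intros qp) auto
  then have rp: "(r \<longlongrightarrow> p) (at_right 0)" using p by simp
  have ev_r: "\<forall>\<^sub>F t in at_right 0. r t \<in> {3/2..p}"
  proof -
    have "\<forall>\<^sub>F t in at_right 0. 3/2 < r t" using p by (intro order_tendstoD(1)[OF rp]) auto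
    with q(2) show ?thesis
    proof eventually_elim
      case (elim t)
      \<comment> \<open>This is \<open>(p - 1) * q t \<le> p * (q t - 1)\<close>, which is
        equivalent to \<open>p \<le> q t\<close>.\<close>
      have "r t \<le> p" using elim p by (simp add: r_def field_simps)
      with elim show ?case by simp
    qed
  qed
  have Lr: "((\<lambda>t. L (r t)) \<longlongrightarrow> L p) (at_right 0)"
    unfolding L_def by (rule continuous_within_tendsto_compose[OF continuous_integral_powr_ln ev_r rp])
  have kt: "((\<lambda>t. k t / t) \<longlongrightarrow> q1 / p * L p) (at_right 0)"
  proof -
    have "((\<lambda>t. (q t - p) / t / q t * L (r t)) \<longlongrightarrow> q1 / p * L p) (at_right 0)"
      using p by (intro tendsto_intros q qp Lr) auto
    then show ?thesis by (simp add: k_def field_simps)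
  qed
  have "((\<lambda>t. (q t - p) / q t * L (r t)) \<longlongrightarrow> (p - p) / p * L p) (at_right 0)"
    using p by (intro tendsto_intros qp Lr) auto
  then have k0: "(k \<longlongrightarrow> 0) (at_right 0)" by (simp add: k_def[abs_def])
  have lim: "((\<lambda>t. ereal ((k t / t - b) / (1 - k t))) \<longlongrightarrow> ereal ((q1 / p * L p - b) / (1 - 0))) (at_right 0)"
    by (intro tendsto_intros kt k0) auto
  have evA: "\<forall>\<^sub>F t in at_right 0. 0 < A t" by (rule order_tendstoD(1)[OF A(1)]) simp
  have evk: "\<forall>\<^sub>F t in at_right 0. k t < 1" by (rule order_tendstoD(2)[OF k0]) simp
  \<comment> \<open>The hypothesis becomes \<open>1 - t * b \<le> A t * (1 - k t)\<close>; solving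
    it for \<open>(A t - 1) / t\<close> gives a quotient with a known limit. The limits are compared
    in \<open>ereal\<close>, where \<open>A'\<close> lives.\<close>
  have "\<forall>\<^sub>F t in at_right 0. ereal ((k t / t - b) / (1 - k t)) \<le> ereal ((A t - 1) / t)"
    using evA evk ev_r le q(2) eventually_at_right_less[of "0::real"]
  proof eventually_elim
    case (elim t)
    have qt: "1 < q t" using elim p by linarith
    have "1 - t * b \<le> A t * (1 / q t + (1 - 1 / q t) * (\<integral>x. a x powr r t \<partial>\<mu>))"
      using elim unfolding r_def by simp
    also have "\<dots> \<le> A t * (1 / q t + (1 - 1 / q t) * (1 - (p - r t) * L (r t)))"
      using integral_powr_convex_bound[of "r t"] elim qt
      by (intro mult_left_mono add_left_mono) (auto simp: a_p L_def)
    also have "1 / q t + (1 - 1 / q t) * (1 - (p - r t) * L (r t)) = 1 - k t"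
    proof -
      have "(1 - 1 / q t) * (p - r t) = (q t - p) / q t"
        using qt by (simp add: r_def field_simps)
      then have "(1 - 1 / q t) * ((p - r t) * L (r t)) = k t"
        unfolding k_def by (simp only: mult.assoc[symmetric])
      then show ?thesis by (simp add: right_diff_distrib)
    qed
    finally have "1 - t * b \<le> A t * (1 - k t)" .
    then have "k t - t * b \<le> (A t - 1) * (1 - k t)" by (simp add: algebra_simps)
    then have "(k t - t * b) / t \<le> (A t - 1) * (1 - k t) / t"
      using elim by (intro divide_right_mono) auto
    moreover have "(k t - t * b) / t = k t / t - b"
      using elim by (simp add: diff_divide_distrib)
    ultimately have "k t / t - b \<le> (A t - 1) / t * (1 - k t)" by simp
    then show ?case using elim by (simp add: pos_divide_le_eq)
  qed
  from tendsto_le[OF _ A(2) lim this] show ?thesis by (simp add: L_def)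
qed

end

section \<open>Bounded functions, and truncation\<close>

text \<open>Hoelder's inequality left in the additive form of Young's: the integral of the power of
  \<open>a\<close> enters without a root, so only its exponent has to be differentiated. Nothing is
  lost at time \<open>0\<close>, where the normalised \<open>a\<close> makes the bracket equal to
  \<open>1\<close>.\<close>

lemma integral_mult_powr_le_Young:
  fixes U a :: "'b \<Rightarrow> real"
  assumes q: "1 < q" and K: "0 < K" and a: "\<And>x. 0 \<le> a x"
    and int: "integrable \<mu> (\<lambda>x. \<bar>U x\<bar> powr q)" "integrable \<mu> (\<lambda>x. a x powr (s * (q / (q - 1))))"
      "integrable \<mu> (\<lambda>x. \<bar>U x\<bar> * a x powr s)"
    and U: "(\<integral>x. \<bar>U x\<bar> powr q \<partial>\<mu>) \<le> K powr q"
  shows "(\<integral>x. \<bar>U x\<bar> * a x powr s \<partial>\<mu>)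
    \<le> K * (1 / q + (1 - 1 / q) * (\<integral>x. a x powr (s * (q / (q - 1))) \<partial>\<mu>))"
proof -
  let ?r = "q / (q - 1)"
  have r: "1 < ?r" "1 / q + 1 / ?r = 1" using q by (auto simp: field_simps)
  have r': "1 / ?r = 1 - 1 / q" using r(2) by linarith
  have "\<bar>U x\<bar> * a x powr s \<le> K * (\<bar>U x\<bar> powr q * (1 / (K powr q * q)) + (1 - 1 / q) * a x powr (s * ?r))" for x
  proof -
    have "\<bar>U x\<bar> / K * a x powr s \<le> (\<bar>U x\<bar> / K) powr q / q + (a x powr s) powr ?r / ?r"
      using q r K by (intro Youngs_inequality) auto
    also have "\<dots> = \<bar>U x\<bar> powr q * (1 / (K powr q * q)) + (1 / ?r) * a x powr (s * ?r)"
      using K by (simp add: powr_divide powr_powr)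
    finally have "\<bar>U x\<bar> / K * a x powr s \<le> \<bar>U x\<bar> powr q * (1 / (K powr q * q)) + (1 - 1 / q) * a x powr (s * ?r)"
      unfolding r' .
    from mult_left_mono[OF this, of K] K show ?thesis by simp
  qed
  then have "(\<integral>x. \<bar>U x\<bar> * a x powr s \<partial>\<mu>)
      \<le> (\<integral>x. K * (\<bar>U x\<bar> powr q * (1 / (K powr q * q)) + (1 - 1 / q) * a x powr (s * ?r)) \<partial>\<mu>)"
    using int by (intro integral_mono integrable_mult_right Bochner_Integration.integrable_add integrable_mult_left) auto
  also have "\<dots> = K * ((\<integral>x. \<bar>U x\<bar> powr q \<partial>\<mu>) * (1 / (K powr q * q))
      + (1 - 1 / q) * (\<integral>x. a x powr (s * ?r) \<partial>\<mu>))"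
    using int by simp
  also have "(\<integral>x. \<bar>U x\<bar> powr q \<partial>\<mu>) * (1 / (K powr q * q)) \<le> K powr q * (1 / (K powr q * q))"
    using q K by (intro mult_right_mono U) auto
  also have "\<dots> = 1 / q" using K by simp
  finally show ?thesis using K by simp
qed

lemma energy_commute: "energy J f g = energy J g f"
  unfolding energy_def by (simp add: mult.commute[of "f _ - f _"])

lemma Lp_1_iff: "f \<in> Lp 1 \<longleftrightarrow> integrable lebesgue f"
  unfolding Lp_def by (auto simp: integrable_abs_iff)

lemma lpnorm_powr: "0 < p \<Longrightarrow> lpnorm p f powr p = (\<integral>x. \<bar>f x\<bar> powr p \<partial>lebesgue)"
  unfolding lpnorm_def by (simp add: powr_powr)

text \<open>Hypercontractivity restated on a right neighbourhood of \<open>0\<close>, where the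
  derivatives are compared; a real \<open>d\<close> below \<open>tinf\<close> provides it even when
  \<open>tinf\<close> is infinite.\<close>

lemma hypercontractive_local:
  assumes "hypercontractive S p tinf q q' A A'"
  shows "((\<lambda>t. (q t - p) / t) \<longlongrightarrow> q' 0) (at_right 0)"
    and "\<forall>\<^sub>F t in at_right 0. p \<le> q t \<and> (\<forall>u0 \<in> Lp p. S t u0 \<in> Lp (q t) \<and> lpnorm (q t) (S t u0) \<le> A t * lpnorm p u0)"
    and "0 < q' 0" "(A \<longlongrightarrow> 1) (at_right 0)" "((\<lambda>h. ereal ((A h - 1) / h)) \<longlongrightarrow> A') (at_right 0)" "A' < \<infinity>"
proof -
  define I where "I = {t::real. 0 \<le> t \<and> ereal t < tinf}"
  from assms have h: "0 < tinf" "mono_on I q" "\<And>t. t \<in> I \<Longrightarrow> (q has_real_derivative q' t) (at t within I)"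
    "q 0 = p" "\<And>t. t \<in> I \<Longrightarrow> \<forall>u0 \<in> Lp p. S t u0 \<in> Lp (q t) \<and> lpnorm (q t) (S t u0) \<le> A t * lpnorm p u0"
    unfolding hypercontractive_def Let_def I_def by auto
  show "0 < q' 0" "(A \<longlongrightarrow> 1) (at_right 0)" "((\<lambda>h. ereal ((A h - 1) / h)) \<longlongrightarrow> A') (at_right 0)" "A' < \<infinity>"
    using assms unfolding hypercontractive_def Let_def by auto
  obtain d where d: "0 < d" "ereal d < tinf"
    using ereal_dense2[OF h(1)] by (metis ereal_less(2))
  have dI: "{0..d} \<subseteq> I" using d using le_less_trans[of "ereal _" "ereal d" tinf] unfolding I_def by auto
  have "0 \<in> I" using dI d by auto
  from h(3)[OF this] have "((\<lambda>t. (q t - p) / t) \<longlongrightarrow> q' 0) (at 0 within I)"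
    by (simp add: has_field_derivative_iff h(4))
  from tendsto_within_subset[OF this dI]
  show "((\<lambda>t. (q t - p) / t) \<longlongrightarrow> q' 0) (at_right 0)"
    using d by (simp add: at_within_Icc_at_right)
  show "\<forall>\<^sub>F t in at_right 0. p \<le> q t \<and> (\<forall>u0 \<in> Lp p. S t u0 \<in> Lp (q t) \<and> lpnorm (q t) (S t u0) \<le> A t * lpnorm p u0)"
    unfolding eventually_at_right_field
  proof (intro exI[of _ d] conjI allI impI d(1))
    fix t assume t: "0 < t" "t < d"
    then have "t \<in> I" using dI by auto
    then show "p \<le> q t" "\<forall>u0 \<in> Lp p. S t u0 \<in> Lp (q t) \<and> lpnorm (q t) (S t u0) \<le> A t * lpnorm p u0"
      using monotone_onD[OF h(2) \<open>0 \<in> I\<close>] h(4) h(5) t by auto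
  qed
qed

section \<open>The logarithmic Sobolev inequality for bounded functions\<close>

context
  fixes J :: "'a::euclidean_space \<Rightarrow> 'a \<Rightarrow> real"
    and S :: "real \<Rightarrow> ('a \<Rightarrow> real) \<Rightarrow> 'a \<Rightarrow> real"
    and p :: real and tinf :: ereal and q q' A :: "real \<Rightarrow> real" and A' :: ereal
  assumes J: "levy_kernel J" and p: "p \<ge> 2" and S: "levy_semigroup J p S"
    and hc: "hypercontractive S p tinf q q' A A'"
begin

text \<open>Boundedness makes the signed power Lipschitz on the range of \<open>f\<close>, hence an
  admissible test function. The conclusion is a lower bound for \<open>A'\<close> because
  \<open>A'\<close> is not yet known to differ from minus infinity.\<close>

lemma bounded_log_Sobolev:
  assumes f: "f \<in> Lp 1" "f \<in> Lp p" "f \<in> HL J" and M: "\<And>x. \<bar>f x\<bar> \<le> M"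
    and P: "P = (\<integral>x. \<bar>f x\<bar> powr p \<partial>lebesgue)" "0 < P"
  shows "integrable lebesgue (\<lambda>x. \<bar>f x\<bar> powr p * ln (\<bar>f x\<bar> powr p))"
    and "ereal ((q' 0 / p\<^sup>2 * ((\<integral>x. \<bar>f x\<bar> powr p * ln (\<bar>f x\<bar> powr p) \<partial>lebesgue) - P * ln P)
      - energy J (\<lambda>x. signed_powr p (f x)) f) / P) \<le> A'"
proof -
  note h = hypercontractive_local[OF hc]
  have fi: "integrable lebesgue (\<lambda>x. \<bar>f x\<bar>)" and fm: "f \<in> borel_measurable lebesgue"
    and fL: "f \<in> Lp 2" using f HL_iff[OF J] by (auto simp: Lp_1_iff Lp_2_iff)
  have fp: "integrable lebesgue (\<lambda>x. \<bar>f x\<bar> powr p)" using f(2) by (simp add: Lp_def)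
  define N where "N = P powr (1 / p)"
  have N: "0 < N" "N powr p = P" using P p by (auto simp: N_def powr_powr)
  have NL: "lpnorm p f = N" by (simp add: lpnorm_def N_def P)
  define a where "a x = \<bar>f x\<bar> / N" for x
  have a: "integrable lebesgue a" "\<And>x. 0 \<le> a x" "\<And>x. a x \<le> M / N"
    using fi N M unfolding a_def by (auto intro: divide_right_mono)
  have ap: "a x powr p = \<bar>f x\<bar> powr p / P" for x
    using N by (simp add: a_def powr_divide)
  have a_p: "(\<integral>x. a x powr p \<partial>lebesgue) = 1" unfolding ap using P by simp
  \<comment> \<open>Normalising \<open>f\<close> to \<open>a = \<bar>f\<bar> / N\<close> turns the
    entropy into \<open>p * P\<close> times the logarithmic integral of \<open>a\<close>; the term
    \<open>ln P\<close> produces the subtracted \<open>P * ln P\<close>.\<close>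
  have fln: "\<bar>f x\<bar> powr p * ln (\<bar>f x\<bar> powr p) = p * P * (a x powr p * ln (a x)) + ln P * \<bar>f x\<bar> powr p" for x
  proof (cases "f x = 0")
    case False
    have "ln (a x) = ln \<bar>f x\<bar> - ln P / p"
      using False P(2) p by (simp add: a_def N_def ln_div)
    then have ln_eq: "ln (\<bar>f x\<bar> powr p) = p * ln (a x) + ln P"
      using False p by (simp add: right_diff_distrib)
    have P_eq: "P * a x powr p = \<bar>f x\<bar> powr p" using P(2) by (simp add: ap)
    show ?thesis unfolding ln_eq unfolding P_eq[symmetric] by (simp add: algebra_simps)
  qed (simp add: a_def)
  have aln: "integrable lebesgue (\<lambda>x. a x powr p * ln (a x))"
    by (rule bounded_powr_ln_integrable[OF a p]) (use p in auto)
  show "integrable lebesgue (\<lambda>x. \<bar>f x\<bar> powr p * ln (\<bar>f x\<bar> powr p))"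
    unfolding fln using aln fp by auto
  have X: "(\<integral>x. \<bar>f x\<bar> powr p * ln (\<bar>f x\<bar> powr p) \<partial>lebesgue) - P * ln P
      = p * P * (\<integral>x. a x powr p * ln (a x) \<partial>lebesgue)"
    unfolding fln using aln fp by (simp add: P(1))
  define g where "g = (\<lambda>x. signed_powr p (f x))"
  have M0: "0 \<le> M" using M[of undefined] by linarith
  have g: "g \<in> HL J"
  proof (rule HL_Lipschitz_comp[OF J f(3)])
    show "g \<in> borel_measurable lebesgue"
      unfolding g_def using fm by measurable
    show "\<bar>g x\<bar> \<le> (p - 1) * M powr (p - 2) * \<bar>f x\<bar>" for x
      using signed_powr_Lipschitz[OF p M[of x], of 0] M0 by (simp add: g_def signed_powr_def)
    show "\<bar>g x - g y\<bar> \<le> (p - 1) * M powr (p - 2) * \<bar>f x - f y\<bar>" for x y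
      using signed_powr_Lipschitz[OF p M M] by (simp add: g_def)
  qed
  have gL: "g \<in> Lp 2" using g HL_iff[OF J] by auto
  have g_abs: "\<bar>g x\<bar> = N powr (p - 1) * a x powr (p - 1)" for x
    using p N by (simp add: g_def abs_signed_powr a_def powr_divide)
  have fg: "(\<integral>x. f x * g x \<partial>lebesgue) = P" by (simp add: g_def mult_signed_powr P(1))
  have sol: "levy_solution J f (\<lambda>t. S t f)" using S fL unfolding levy_semigroup_def by auto
  \<comment> \<open>Taking \<open>b\<close> strictly above \<open>energy J f g / P\<close> leaves
    room for the strict bound required by the pairing estimate; afterwards \<open>b\<close>
    decreases to that quotient.\<close>
  have core: "ereal (q' 0 / p * (\<integral>x. a x powr p * ln (a x) \<partial>lebesgue) - b) \<le> A'"
    if b: "energy J f g / P < b" for b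
  proof (rule derivative_ge_of_Hoelder_defect[OF a p a_p h(1) _ h(4,5)])
    show "\<forall>\<^sub>F t in at_right 0. p \<le> q t" using h(2) by (rule eventually_mono) simp
    have "energy J f g < b * P" using b P by (simp add: pos_divide_less_eq)
    note pair = levy_solution_pairing_upper[OF J sol f(3) g this]
    have "\<forall>\<^sub>F t in at_right 0. 0 < A t" by (rule order_tendstoD(1)[OF h(4)]) simp
    with pair h(2) eventually_at_right_less[of "0::real"]
    show "\<forall>\<^sub>F t in at_right 0. 1 - t * b \<le>
      A t * (1 / q t + (1 - 1 / q t) * (\<integral>x. a x powr ((p - 1) * (q t / (q t - 1))) \<partial>lebesgue))"
    proof eventually_elim
      case (elim t)
      let ?U = "S t f" and ?q = "q t"
      let ?c = "1 / ?q + (1 - 1 / ?q) * (\<integral>x. a x powr ((p - 1) * (?q / (?q - 1))) \<partial>lebesgue)"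
      have q1: "1 < ?q" using elim p by linarith
      have Uq: "integrable lebesgue (\<lambda>x. \<bar>?U x\<bar> powr ?q)" and Un: "lpnorm ?q ?U \<le> A t * N"
        using elim f(2) by (auto simp: Lp_def NL)
      have UL: "?U \<in> Lp 2" using sol elim unfolding levy_solution_def by auto
      have Ug: "integrable lebesgue (\<lambda>x. ?U x * g x)" by (rule Lp_2_mult_integrable[OF UL gL])
      have abs_eq: "\<bar>?U x * g x\<bar> = N powr (p - 1) * (\<bar>?U x\<bar> * a x powr (p - 1))" for x
        by (simp add: abs_mult g_abs)
      have int3: "integrable lebesgue (\<lambda>x. \<bar>?U x\<bar> * a x powr (p - 1))"
        using integrable_abs[OF Ug] N unfolding abs_eq by simp
      have "1 \<le> (p - 1) * (?q / (?q - 1))"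
        using q1 p mult_mono[of 1 "p - 1" 1 "?q / (?q - 1)"] by simp
      note int2 = bounded_powr_integrable[OF a p this]
      have "(\<integral>x. \<bar>?U x\<bar> powr ?q \<partial>lebesgue) = lpnorm ?q ?U powr ?q"
        using q1 by (simp add: lpnorm_powr)
      also have "\<dots> \<le> (A t * N) powr ?q" using Un q1 by (intro powr_mono2) auto
      finally have Ub: "(\<integral>x. \<bar>?U x\<bar> powr ?q \<partial>lebesgue) \<le> (A t * N) powr ?q" .
      have K: "0 < A t * N" using elim N by simp
      \<comment> \<open>The pairing estimate bounds the integral from below, Young's inequality with
        the hypercontractive bound \<open>A t * N\<close> from above. Since
        \<open>N powr (p - 1) * N = P\<close>, division by \<open>P\<close> normalises both
        sides.\<close>
      have "P - t * (b * P) \<le> (\<integral>x. ?U x * g x \<partial>lebesgue)" using elim(1) by (simp add: fg)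
      also have "\<dots> \<le> (\<integral>x. \<bar>?U x * g x\<bar> \<partial>lebesgue)"
        by (intro integral_mono Ug integrable_abs) auto
      also have "\<dots> = N powr (p - 1) * (\<integral>x. \<bar>?U x\<bar> * a x powr (p - 1) \<partial>lebesgue)"
        unfolding abs_eq by simp
      also have "\<dots> \<le> N powr (p - 1) * (A t * N * ?c)"
        by (intro mult_left_mono integral_mult_powr_le_Young[OF q1 K a(2) Uq int2 int3 Ub]) simp
      also have "\<dots> = (N powr (p - 1) * N powr 1) * (A t * ?c)" using N by simp
      also have "N powr (p - 1) * N powr 1 = P" unfolding powr_add[symmetric] using N by simp
      finally have "P * (1 - t * b) \<le> P * (A t * ?c)" by (simp add: algebra_simps)
      then show ?case using P by simp
    qed
  qed
  have "ereal (q' 0 / p * (\<integral>x. a x powr p * ln (a x) \<partial>lebesgue) - energy J f g / P) \<le> A'"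
  proof (rule ereal_le_epsilon2)
    fix e :: real assume "0 < e"
    then have "ereal (q' 0 / p * (\<integral>x. a x powr p * ln (a x) \<partial>lebesgue) - (energy J f g / P + e)) \<le> A'"
      by (intro core) simp
    then show "ereal (q' 0 / p * (\<integral>x. a x powr p * ln (a x) \<partial>lebesgue) - energy J f g / P) \<le> A' + ereal e"
      by (cases A') auto
  qed
  also have "q' 0 / p * (\<integral>x. a x powr p * ln (a x) \<partial>lebesgue) - energy J f g / P
    = (q' 0 / p\<^sup>2 * ((\<integral>x. \<bar>f x\<bar> powr p * ln (\<bar>f x\<bar> powr p) \<partial>lebesgue) - P * ln P)
      - energy J (\<lambda>x. signed_powr p (f x)) f) / P"
    unfolding X g_def energy_commute[of J "\<lambda>x. signed_powr p (f x)" f]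
    using P(2) p by (simp add: power2_eq_square field_simps)
  finally show "ereal ((q' 0 / p\<^sup>2 * ((\<integral>x. \<bar>f x\<bar> powr p * ln (\<bar>f x\<bar> powr p) \<partial>lebesgue) - P * ln P)
      - energy J (\<lambda>x. signed_powr p (f x)) f) / P) \<le> A'" .
qed

end

section \<open>Truncation and forms with nonnegative density\<close>

definition clamp_real :: "real \<Rightarrow> real \<Rightarrow> real" where
  "clamp_real n a = max (- n) (min n a)"

lemma abs_clamp_real: "0 \<le> n \<Longrightarrow> \<bar>clamp_real n a\<bar> = min \<bar>a\<bar> n"
  by (auto simp: clamp_real_def max_def min_def abs_if)

lemma clamp_real_contraction:
  assumes "0 \<le> n"
  shows "\<bar>clamp_real n a - clamp_real n b\<bar> \<le> \<bar>a - b\<bar>"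
  using assms by (auto simp: clamp_real_def max_def min_def abs_if)

lemma clamp_real_measurable [measurable]: "clamp_real n \<in> borel_measurable borel"
  unfolding clamp_real_def[abs_def] by measurable

text \<open>For \<open>b \<le> a\<close> both factors are nonnegative and shrink under truncation:
  clamping is a contraction, and the change it makes to the signed power is nonincreasing.
  Integrated against the kernel, this makes \<open>energy\<close> decrease.\<close>

lemma signed_powr_clamp_real_mult_le:
  assumes p: "2 \<le> p" and n: "0 \<le> n"
  shows "(signed_powr p (clamp_real n a) - signed_powr p (clamp_real n b)) * (clamp_real n a - clamp_real n b)
    \<le> (signed_powr p a - signed_powr p b) * (a - b)"
proof -
  have main: "(signed_powr p (clamp_real n a) - signed_powr p (clamp_real n b)) * (clamp_real n a - clamp_real n b)
    \<le> (signed_powr p a - signed_powr p b) * (a - b)" if ba: "b \<le> a" for a b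
  proof (rule mult_mono)
    show "clamp_real n a - clamp_real n b \<le> a - b" "0 \<le> clamp_real n a - clamp_real n b"
      using n ba by (auto simp: clamp_real_def max_def min_def)
    show "0 \<le> signed_powr p a - signed_powr p b" using signed_powr_mono[OF p ba] by simp
    have "signed_powr p (clamp_real n a) - signed_powr p a \<le> signed_powr p (clamp_real n b) - signed_powr p b"
    proof -
      consider "n < b" | "b \<le> n" "n < a" | "- n \<le> b" "a \<le> n" | "b < - n" "a \<le> n" "- n \<le> a" | "a < - n"
        using ba by linarith
      then show ?thesis
      proof cases
        case 1
        then show ?thesis using n ba signed_powr_mono[OF p ba] by (simp add: clamp_real_def)
      next
        case 2
        have "clamp_real n a = n" "b \<le> clamp_real n b" using 2 n by (auto simp: clamp_real_def)
        then show ?thesis using signed_powr_mono[OF p, of n a] signed_powr_mono[OF p, of b "clamp_real n b"] 2 by simp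
      next
        case 3
        have "clamp_real n a = a" "clamp_real n b = b" using 3 ba by (auto simp: clamp_real_def)
        then show ?thesis by simp
      next
        case 4
        have "clamp_real n a = a" "b \<le> clamp_real n b" using 4 by (auto simp: clamp_real_def)
        then show ?thesis using signed_powr_mono[OF p, of b "clamp_real n b"] by simp
      next
        case 5
        have "clamp_real n a = - n" "clamp_real n b = - n" using 5 n ba by (auto simp: clamp_real_def)
        then show ?thesis using signed_powr_mono[OF p ba] by simp
      qed
    qed
    then show "signed_powr p (clamp_real n a) - signed_powr p (clamp_real n b) \<le> signed_powr p a - signed_powr p b"
      by simp
  qed
  show ?thesis
  proof (cases "b \<le> a")
    case False
    then show ?thesis using main[of a b] by (simp add: minus_mult_commute[symmetric] algebra_simps)
  qed (rule main)
qed

text \<open>\<open>s * ln s\<close> is not monotone near \<open>0\<close>, but truncating at a level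
  of at least \<open>1\<close> alters only values above \<open>1\<close>, where it is
  increasing.\<close>

lemma powr_ln_min_mono:
  fixes y :: real
  assumes "1 \<le> m" "m \<le> n" "0 \<le> p" "0 \<le> y"
  shows "min y m powr p * ln (min y m powr p) \<le> min y n powr p * ln (min y n powr p)"
proof (cases "y \<le> m")
  case False
  then have "1 \<le> min y m" "min y m \<le> min y n" using assms by auto
  then have "1 \<le> min y m powr p" "min y m powr p \<le> min y n powr p"
    using assms by (auto intro!: powr_mono2 ge_one_powr_ge_zero)
  then show ?thesis by (intro mult_mono ln_mono ln_ge_zero) linarith+
qed (use assms in \<open>simp add: min_absorb1\<close>)

text \<open>The signed power of an unbounded \<open>f\<close> may leave the form domain, so
  integrability of the mixed density comes from its sign: a nonnegative density with finite extended
  integral is integrable.\<close>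

lemma form_nonneg_product:
  assumes J: "levy_kernel J" and f: "f \<in> borel_measurable lebesgue" and g: "g \<in> borel_measurable lebesgue"
    and nn: "\<And>x y. 0 \<le> (g x - g y) * (f x - f y)"
  shows "0 \<le> form J g f"
    and "form J g f < \<infinity> \<Longrightarrow> integrable lebesgue (\<lambda>(x, y). (g x - g y) * (f x - f y) * J x y)"
    and "form J g f < \<infinity> \<Longrightarrow> form J g f = ereal (energy J g f)"
proof -
  let ?d = "\<lambda>(x, y). (g x - g y) * (f x - f y) * J x y"
  have d: "0 \<le> ?d z" for z using nn J_nonneg[OF J] by (cases z) simp
  show "0 \<le> form J g f" unfolding form_def ext_lint_nonneg[of ?d, OF d] by simp
  assume fin: "form J g f < \<infinity>"
  show i: "integrable lebesgue ?d"
  proof (rule ext_lint_nonneg_finite_imp_integrable[OF d form_density_measurable[OF J g f]])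
    show "ext_lint lebesgue ?d < \<infinity>" using fin unfolding form_def by (auto simp: less_top)
  qed
  show "form J g f = ereal (energy J g f)"
    unfolding form_def energy_def ext_lint_integrable[OF i] by simp
qed

section \<open>From truncations to general functions\<close>

theorem theorem3p11:
  fixes J :: "'a::euclidean_space \<Rightarrow> 'a \<Rightarrow> real"
    and S :: "real \<Rightarrow> ('a \<Rightarrow> real) \<Rightarrow> 'a \<Rightarrow> real"
    and p :: real and tinf :: ereal
    and q q' A :: "real \<Rightarrow> real" and A' :: ereal
    and f :: "'a \<Rightarrow> real"
  assumes "levy_kernel J"
    and "p \<ge> 2"
    and "levy_semigroup J p S"
    and "hypercontractive S p tinf q q' A A'"
    and "f \<in> Lp 1 \<inter> Lp p \<inter> HL J"
  shows "Ent (\<lambda>x. \<bar>f x\<bar> powr p)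
    \<le> (ereal (p\<^sup>2) * A' / ereal (q' 0)) * ereal (lpnorm p f powr p)
      + ereal (p\<^sup>2 / q' 0) * form J (\<lambda>x. \<bar>f x\<bar> powr (p - 2) * f x) f"
proof -
  note J = assms(1) and p = assms(2)
  have f: "f \<in> Lp 1" "f \<in> Lp p" "f \<in> HL J" using assms(5) by auto
  note q0 = hypercontractive_local(3)[OF assms(4)] and A'_fin = hypercontractive_local(6)[OF assms(4)]
  have fi: "integrable lebesgue f" using f(1) by (simp add: Lp_1_iff)
  have fm: "f \<in> borel_measurable lebesgue" and fp: "integrable lebesgue (\<lambda>x. \<bar>f x\<bar> powr p)"
    using f(2) by (auto simp: Lp_def)
  define P where "P = (\<integral>x. \<bar>f x\<bar> powr p \<partial>lebesgue)"
  have P_norm: "lpnorm p f powr p = P" using p by (simp add: lpnorm_powr P_def)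
  have P0: "0 \<le> P" unfolding P_def by simp
  let ?g = "\<lambda>x. signed_powr p (f x)"
  have g_eq: "(\<lambda>x. \<bar>f x\<bar> powr (p - 2) * f x) = ?g" by (simp add: signed_powr_def)
  have mono_prod: "0 \<le> (signed_powr p a - signed_powr p b) * (a - b)" for a b
    using signed_powr_mono[OF p, of a b] signed_powr_mono[OF p, of b a]
    by (cases "a \<le> b") (auto simp: mult_nonpos_nonpos)
  have gm: "?g \<in> borel_measurable lebesgue" using fm by measurable
  note form_g = form_nonneg_product[OF J fm gm mono_prod]
  have f0_iff: "(AE x in lebesgue. f x = 0) \<longleftrightarrow> P = 0"
    unfolding P_def by (subst integral_nonneg_eq_0_iff_AE[OF fp]) auto
  show ?thesis
  proof (cases "P = 0")
    case True
    \<comment> \<open>Here \<open>f\<close> vanishes almost everywhere. The term with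
      \<open>A'\<close> is a product with \<open>0\<close>, hence \<open>0\<close> in
      \<open>ereal\<close> whatever the value of \<open>A'\<close>.\<close>
    with f0_iff have ae: "AE x in lebesgue. f x = 0" by simp
    have "(\<integral>\<^sup>+ x. ennreal (\<bar>\<bar>f x\<bar> powr p\<bar> * ln \<bar>\<bar>f x\<bar> powr p\<bar>) \<partial>lebesgue) = (\<integral>\<^sup>+ (x::'a). 0 \<partial>lebesgue)"
      "(\<integral>\<^sup>+ x. ennreal (- (\<bar>\<bar>f x\<bar> powr p\<bar> * ln \<bar>\<bar>f x\<bar> powr p\<bar>)) \<partial>lebesgue) = (\<integral>\<^sup>+ (x::'a). 0 \<partial>lebesgue)"
      by (rule nn_integral_cong_AE, use ae in eventually_elim, simp)+
    then have "Ent (\<lambda>x. \<bar>f x\<bar> powr p) = 0"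
      unfolding Ent_def ext_lint_def using True by (simp add: zero_ennreal.rep_eq flip: P_def)
    also have "0 \<le> ereal (p\<^sup>2 / q' 0) * form J ?g f"
      using q0 form_g(1) by (intro ereal_0_le_mult) auto
    finally show ?thesis unfolding g_eq P_norm True by (simp flip: zero_ereal_def)
  next
    case False
    with P0 have P: "0 < P" by simp
    show ?thesis
    proof (cases "form J ?g f < \<infinity>")
      case False
      \<comment> \<open>The right side is then infinite: in \<open>ereal\<close>, adding infinity
        gives infinity whatever the other summand.\<close>
      then have "form J ?g f = \<infinity>" by simp
      then show ?thesis unfolding g_eq using q0 p by simp
    next
      case fin: True
      define E where "E = energy J ?g f"
      have form_E: "form J ?g f = ereal E" unfolding E_def by (rule form_g(3)[OF fin])
      \<comment> \<open>The level \<open>Suc n\<close> is at least \<open>1\<close>, as the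
        monotonicity of the entropy integrands requires.\<close>
      define F where "F n x = clamp_real (real (Suc n)) (f x)" for n x
      have F_abs: "\<bar>F n x\<bar> = min \<bar>f x\<bar> (real (Suc n))" for n x
        unfolding F_def by (rule abs_clamp_real) simp
      have Fm [measurable]: "F n \<in> borel_measurable lebesgue" for n
        unfolding F_def using fm by measurable
      have F_p: "\<bar>F n x\<bar> powr p \<le> \<bar>f x\<bar> powr p" for n x
        using p by (intro powr_mono2) (auto simp: F_abs)
      have FL: "F n \<in> Lp 1" "F n \<in> Lp p" "F n \<in> HL J" for n
      proof -
        show "F n \<in> Lp 1" unfolding Lp_1_iff
          by (rule Bochner_Integration.integrable_bound[OF fi]) (auto simp: F_abs)
        show "F n \<in> Lp p" unfolding Lp_def
          using Bochner_Integration.integrable_bound[OF fp, of "\<lambda>x. \<bar>F n x\<bar> powr p"] F_p by auto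
        show "F n \<in> HL J"
        proof (rule HL_Lipschitz_comp[OF J f(3) Fm])
          show "\<bar>F n x\<bar> \<le> 1 * \<bar>f x\<bar>" for x by (simp add: F_abs)
          show "\<bar>F n x - F n y\<bar> \<le> 1 * \<bar>f x - f y\<bar>" for x y
            using clamp_real_contraction[of "real (Suc n)" "f x" "f y"] by (simp add: F_def)
        qed
      qed
      define Pn where "Pn n = (\<integral>x. \<bar>F n x\<bar> powr p \<partial>lebesgue)" for n
      define X where "X n = (\<integral>x. \<bar>F n x\<bar> powr p * ln (\<bar>F n x\<bar> powr p) \<partial>lebesgue)" for n
      have F_ev: "\<forall>\<^sub>F n in sequentially. \<bar>F n x\<bar> = \<bar>f x\<bar>" for x
      proof -
        obtain m :: nat where "\<bar>f x\<bar> \<le> real m" using real_arch_simple[of "\<bar>f x\<bar>"] by auto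
        then show ?thesis
          by (intro eventually_sequentiallyI[of m]) (auto simp: F_abs)
      qed
      \<comment> \<open>At each point the truncation is eventually the identity, so no continuity of
        \<open>\<phi>\<close> is involved.\<close>
      have F_lim: "(\<lambda>n. \<phi> \<bar>F n x\<bar>) \<longlonglongrightarrow> \<phi> \<bar>f x\<bar>" for \<phi> :: "real \<Rightarrow> real" and x
        by (rule tendsto_eventually, rule eventually_mono[OF F_ev[of x]]) simp
      have Pn_lim: "Pn \<longlonglongrightarrow> P"
        unfolding Pn_def P_def
      proof (rule integral_dominated_convergence[where w = "\<lambda>x. \<bar>f x\<bar> powr p"])
        show "AE x in lebesgue. (\<lambda>n. \<bar>F n x\<bar> powr p) \<longlonglongrightarrow> \<bar>f x\<bar> powr p"
          by (intro AE_I2 F_lim)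
        show "AE x in lebesgue. norm (\<bar>F n x\<bar> powr p) \<le> \<bar>f x\<bar> powr p" for n
          using F_p by (intro AE_I2) simp
        show "(\<lambda>x. \<bar>f x\<bar> powr p) \<in> borel_measurable lebesgue" using fm by measurable
        show "(\<lambda>x. \<bar>F n x\<bar> powr p) \<in> borel_measurable lebesgue" for n by measurable
      qed (rule fp)
      have Pn_pos: "0 < Pn n" for n
      proof -
        have "Pn n \<noteq> 0"
        proof
          assume "Pn n = 0"
          then have "AE x in lebesgue. \<bar>F n x\<bar> powr p = 0"
            unfolding Pn_def using FL(2)[of n]
            by (subst (asm) integral_nonneg_eq_0_iff_AE) (auto simp: Lp_def)
          then have "AE x in lebesgue. f x = 0"
          proof eventually_elim
            case (elim x)
            then have "\<bar>F n x\<bar> = 0" by simp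
            then show ?case unfolding F_abs by (simp add: min_def split: if_splits)
          qed
          with f0_iff P show False by simp
        qed
        moreover have "0 \<le> Pn n" unfolding Pn_def by simp
        ultimately show ?thesis by simp
      qed
      have F_bd: "\<bar>F n x\<bar> \<le> real (Suc n)" for n x by (simp add: F_abs)
      note bl = bounded_log_Sobolev[OF J p assms(3,4) FL F_bd Pn_def Pn_pos]
      have En: "energy J (\<lambda>x. signed_powr p (F n x)) (F n) \<le> E" for n
        unfolding E_def energy_def
      proof (intro mult_left_mono integral_mono_AE' AE_I2)
        show "integrable lebesgue (\<lambda>(x, y). (?g x - ?g y) * (f x - f y) * J x y)"
          by (rule form_g(2)[OF fin])
        fix z :: "'a \<times> 'a"
        obtain x y where z: "z = (x, y)" by (cases z)
        have "(signed_powr p (F n x) - signed_powr p (F n y)) * (F n x - F n y) * J x y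
            \<le> (?g x - ?g y) * (f x - f y) * J x y"
          unfolding F_def
          by (intro mult_right_mono signed_powr_clamp_real_mult_le p J_nonneg[OF J]) simp
        then show "(case z of (x, y) \<Rightarrow> (signed_powr p (F n x) - signed_powr p (F n y)) * (F n x - F n y) * J x y)
            \<le> (case z of (x, y) \<Rightarrow> (?g x - ?g y) * (f x - f y) * J x y)"
          unfolding z by simp
        show "0 \<le> (case z of (x, y) \<Rightarrow> (?g x - ?g y) * (f x - f y) * J x y)"
          unfolding z using mult_nonneg_nonneg[OF mono_prod J_nonneg[OF J]] by simp
      qed simp
      \<comment> \<open>The lower bound for a truncation excludes minus infinity, so
        \<open>A'\<close> is real from here on.\<close>
      obtain \<alpha> where \<alpha>: "A' = ereal \<alpha>"
        using bl(2)[of 0] A'_fin by (cases A') auto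
      have X_le: "X n \<le> p\<^sup>2 / q' 0 * (\<alpha> * Pn n + E) + Pn n * ln (Pn n)" for n
      proof -
        have "(q' 0 / p\<^sup>2 * (X n - Pn n * ln (Pn n)) - energy J (\<lambda>x. signed_powr p (F n x)) (F n)) / Pn n \<le> \<alpha>"
          using bl(2)[of n] unfolding \<alpha> X_def by simp
        then have "q' 0 / p\<^sup>2 * (X n - Pn n * ln (Pn n)) - energy J (\<lambda>x. signed_powr p (F n x)) (F n) \<le> \<alpha> * Pn n"
          using Pn_pos[of n] by (simp add: pos_divide_le_eq)
        then have "q' 0 / p\<^sup>2 * (X n - Pn n * ln (Pn n)) \<le> \<alpha> * Pn n + E" using En[of n] by linarith
        then have "p\<^sup>2 / q' 0 * (q' 0 / p\<^sup>2 * (X n - Pn n * ln (Pn n))) \<le> p\<^sup>2 / q' 0 * (\<alpha> * Pn n + E)"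
          using q0 by (intro mult_left_mono) auto
        then show ?thesis using q0 p by simp
      qed
      define R where "R = p\<^sup>2 / q' 0 * (\<alpha> * P + E) + P * ln P"
      have R_lim: "(\<lambda>n. p\<^sup>2 / q' 0 * (\<alpha> * Pn n + E) + Pn n * ln (Pn n)) \<longlonglongrightarrow> R"
        unfolding R_def using P by (intro tendsto_intros Pn_lim) auto
      have X_mono: "\<bar>F m x\<bar> powr p * ln (\<bar>F m x\<bar> powr p) \<le> \<bar>F n x\<bar> powr p * ln (\<bar>F n x\<bar> powr p)"
        if "m \<le> n" for m n x
        unfolding F_abs by (rule powr_ln_min_mono) (use that p in auto)
      have X_inc: "incseq X"
        unfolding X_def by (intro monoI integral_mono bl(1) X_mono)
      \<comment> \<open>The right sides of \<open>X_le\<close> converge, hence are bounded; this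
        bounds the increasing sequence \<open>X\<close> and makes it converge.\<close>
      obtain C where C: "\<And>n. norm (p\<^sup>2 / q' 0 * (\<alpha> * Pn n + E) + Pn n * ln (Pn n)) \<le> C"
        using convergent_imp_Bseq[OF convergentI[OF R_lim]] by (rule BseqE) blast
      have "X n \<le> C" for n using X_le[of n] C[of n] unfolding real_norm_def by linarith
      then obtain x0 where x0: "X \<longlonglongrightarrow> x0"
        using incseq_convergent[OF X_inc] by blast
      have x0_R: "x0 \<le> R" by (rule LIMSEQ_le[OF x0 R_lim]) (intro exI allI impI X_le)
      let ?h = "\<lambda>x. \<bar>f x\<bar> powr p * ln (\<bar>f x\<bar> powr p)"
      have mono_F: "AE x in lebesgue. mono (\<lambda>n. \<bar>F n x\<bar> powr p * ln (\<bar>F n x\<bar> powr p))"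
        by (intro AE_I2 monoI X_mono)
      have lim_F: "AE x in lebesgue. (\<lambda>n. \<bar>F n x\<bar> powr p * ln (\<bar>F n x\<bar> powr p)) \<longlonglongrightarrow> ?h x"
        by (intro AE_I2 F_lim)
      have hm: "?h \<in> borel_measurable lebesgue" using fm by measurable
      \<comment> \<open>Monotone convergence gives both the integrability of the entropy integrand
        and its integral \<open>x0\<close>, so the extended integral in \<open>Ent\<close> is a real
        number.\<close>
      note h = integrable_monotone_convergence[OF bl(1) mono_F lim_F x0[unfolded X_def] hm]
        integral_monotone_convergence[OF bl(1) mono_F lim_F x0[unfolded X_def] hm]
      have "Ent (\<lambda>x. \<bar>f x\<bar> powr p) = ereal (x0 - P * ln P)"
        unfolding Ent_def using ext_lint_integrable[OF h(1)] h(2) by (simp add: P_def)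
      also have "\<dots> \<le> ereal (p\<^sup>2 / q' 0 * (\<alpha> * P + E))"
        using x0_R unfolding R_def by simp
      also have "\<dots> = (ereal (p\<^sup>2) * A' / ereal (q' 0)) * ereal P + ereal (p\<^sup>2 / q' 0) * form J ?g f"
        unfolding \<alpha> form_E using q0 by (simp add: distrib_left)
      finally show ?thesis unfolding g_eq P_norm .
    qed
  qed
qed

end
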